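(* For all real numbers $C>\delta>0$, the strip $\{s\in\mathbb{C}:-C\le\operatorname{Re}(s)\le-\delta\}$ contains only finitely many zeros of $D$.
   Context: Here $\zeta$ is the Riemann zeta function. $D$ is the function given by $D(s)=\sum_{n\ge1}\zeta(2n)\,n^{-s}$ for $\operatorname{Re}(s)>1$, continued meromorphically to $\mathbb{C}$ by $D(s)=\zeta(s)+E(s)$, where $E(s)=\sum_{n\ge1}(\zeta(2n)-1)n^{-s}$ converges absolutely for all $s\in\mathbb{C}$ and is entire; the only singularity of $D$ is a simple pole at $s=1$. *)

theory Defs
  imports "HOL-Complex_Analysis.Complex_Analysis"
begin

(* The Riemann zeta function as the analytic continuation of its Dirichlet series to the
   complex plane punctured at 1. Such a continuation exists and, the punctured plane being
   connected, is unique away from 1; only the value at the pole s = 1 is left unspecified. *)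
definition zeta :: "complex \<Rightarrow> complex" where
  "zeta = (SOME f. f holomorphic_on (- {1}) \<and>
     (\<forall>s. Re s > 1 \<longrightarrow> (\<lambda>n. of_nat (Suc n) powr (- s)) sums f s))"

(* Series over n \<ge> 1 are indexed by Suc n. *)
definition E_fun :: "complex \<Rightarrow> complex" where
  "E_fun s = (\<Sum>n. (zeta (of_nat (2 * Suc n)) - 1) * of_nat (Suc n) powr (- s))"

(* For Re s > 1 this is the sum of zeta(2n) n^(-s) over n \<ge> 1; the sum zeta + E_fun is its
   meromorphic continuation. The value at the simple pole s = 1 has no meaning. *)
definition D_fun :: "complex \<Rightarrow> complex" where
  "D_fun s = zeta s + E_fun s"

end

theory Submission
  imports Defs
begin

text \<open>For \<open>Re s < 0\<close> the functional equation writes \<open>\<zeta>(s)\<close> as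
  \<open>2 (2 \<pi>)\<^sup>s\<^sup>-\<^sup>1 sin (\<pi> s / 2) \<Gamma>(1 - s) \<zeta>(1 - s)\<close>. In the strip
  \<open>\<zeta>(1 - s)\<close> is bounded away from \<open>0\<close>, while \<open>sin (\<pi> s / 2) \<Gamma>(1 - s)\<close> grows at
  least like \<open>\<bar>Im s\<bar>\<^sup>1\<^sup>/\<^sup>2\<close>; as \<open>E\<close> is bounded there, the zeros of \<open>\<zeta> + E\<close> lie in
  a compact set. The functional equation is obtained for real \<open>-1 < s < 0\<close> by integrating
  \<open>1 / (e\<^sup>x - 1) - 1 / x + 1 / 2 = (\<Sum>k\<ge>1. 2 x / (x\<^sup>2 + 4 \<pi>\<^sup>2 k\<^sup>2))\<close> against \<open>x\<^sup>s\<^sup>-\<^sup>1\<close>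
  term by term, and it serves at the same time to continue \<open>\<zeta>\<close> to \<open>Re s \<le> -1\<close>.\<close>

section \<open>Mellin transforms\<close>

text \<open>\<open>zeta\<close> is a choice among functions with two properties, so a continuation
  must be built before anything can be said about it; uniqueness on the punctured plane then
  transfers the functional equation. The obstacle is that the Mellin integral of 1 / (e^x - 1)
  converges only for Re s > 1, and that of 1 / (e^x - 1) - 1 / x + 1 / 2 only for -1 < Re s < 0: the
  ranges are disjoint. Removing 1 / x - 1 / 2 on x < 1 alone gives a single integral on Re s > -1,
  which differs from each of them by elementary terms and so joins the Dirichlet series to the
  functional equation. The square root in the growth comes from |Gamma(1 + i y)|^2 = pi y / sinh(pi
  y), whose exponential decay cancels the growth of the sine; larger real parts are compared with
  this line by monotonicity, in place of Stirling's formula. To the right of 1, zeta is kept away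
  from 0 by sieving with finitely many primes, so no infinite product has to converge. Confining the
  zeros to a compact set is not yet finiteness: the same growth also shows that D is not constant,
  hence that its zeros are isolated.\<close>

lemma mellin_transform_holomorphic:
  fixes f :: "real \<Rightarrow> real"
  assumes f [measurable]: "f \<in> borel_measurable borel"
    and int: "\<And>\<sigma>. \<sigma> > a \<Longrightarrow> set_integrable lborel {0<..} (\<lambda>x. x powr (\<sigma> - 1) * f x)"
  shows "(\<lambda>s. LINT x:{0<..}|lborel. of_real x powr (s - 1) * complex_of_real (f x))
           holomorphic_on {s. Re s > a}"
proof -
  have "\<exists>r>0. (\<lambda>s. LINT x:{0<..}|lborel. of_real x powr (s - 1) * complex_of_real (f x))
           holomorphic_on ball s0 r" if s0: "Re s0 > a" for s0
  proof -
    \<comment> \<open>Half the distance to the boundary line, so that both \<open>Re s0 + r\<close>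
      and \<open>Re s0 - r\<close> still exceed \<open>a\<close>.\<close>
    define r where "r = (Re s0 - a) / 2"
    have r: "r > 0" using s0 by (simp add: r_def)
    \<comment> \<open>Taylor coefficients at \<open>s0\<close>, from expanding x^(s - s0) = exp((s -
      s0) ln x) under the integral.\<close>
    define c where "c = (\<lambda>k. LINT x:{0<..}|lborel. of_real x powr (s0 - 1) * complex_of_real (f x)
                          * of_real (ln x) ^ k / fact k)"
    \<comment> \<open>Integrable majorant of all partial sums of the exponential series, since exp(r
      |ln x|) <= x^r + x^(-r).\<close>
    define W where "W = (\<lambda>x. indicator {0<..} x * \<bar>x powr ((Re s0 + r) - 1) * f x\<bar> +
                             indicator {0<..} x * \<bar>x powr ((Re s0 - r) - 1) * f x\<bar>)"
    have W_int: "integrable lborel W"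
    proof -
      have *: "integrable lborel (\<lambda>x. indicator {0<..} x * \<bar>x powr (\<sigma> - 1) * f x\<bar>)" if "\<sigma> > a" for \<sigma>
        using integrable_abs[OF int[OF that, unfolded set_integrable_def]] by (simp add: abs_mult)
      then show ?thesis
        unfolding W_def using s0 r by (intro Bochner_Integration.integrable_add *) (auto simp: r_def field_simps)
    qed
    have "(\<lambda>k. c k * (w - s0) ^ k) sums
            (LINT x:{0<..}|lborel. of_real x powr (w - 1) * complex_of_real (f x))"
      if w: "w \<in> ball s0 r" for w
    proof -
      define d where "d = w - s0"
      have d: "norm d \<le> r" using w by (simp add: d_def dist_norm norm_minus_commute)
      define T where "T = (\<lambda>k x. indicator {0<..} x *\<^sub>R (of_real x powr (s0 - 1) * complex_of_real (f x)
                          * of_real (ln x) ^ k / fact k * d ^ k))"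
      have [measurable]: "T k \<in> borel_measurable lborel" for k
        unfolding T_def by measurable
      have nT: "norm (T k x) = indicator {0<..} x * (x powr (Re s0 - 1) * \<bar>f x\<bar>) *
                  ((\<bar>ln x\<bar> * norm d) ^ k /\<^sub>R fact k)" for k x
        by (auto simp: T_def norm_mult norm_divide norm_power norm_powr_real_powr indicator_def
              power_mult_distrib field_simps)
      have sums_T: "(\<lambda>k. norm (T k x)) sums (indicator {0<..} x * (x powr (Re s0 - 1) * \<bar>f x\<bar>) * exp (\<bar>ln x\<bar> * norm d))" for x
        unfolding nT by (intro sums_mult exp_converges)
      have le_W: "indicator {0<..} x * (x powr (Re s0 - 1) * \<bar>f x\<bar>) * exp (\<bar>ln x\<bar> * norm d) \<le> W x" for x
      proof (cases "x > 0")
        case True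
        have "exp (\<bar>ln x\<bar> * norm d) \<le> exp (\<bar>ln x\<bar> * r)"
          using d by (intro iffD2[OF exp_le_cancel_iff] mult_left_mono) auto
        also have "\<dots> \<le> x powr r + x powr (-r)"
          using True by (auto simp: powr_def abs_if mult.commute)
        finally have "x powr (Re s0 - 1) * \<bar>f x\<bar> * exp (\<bar>ln x\<bar> * norm d) \<le>
            x powr (Re s0 - 1) * \<bar>f x\<bar> * (x powr r + x powr (-r))"
          by (intro mult_left_mono) auto
        also have "\<dots> = (x powr (Re s0 - 1) * x powr r) * \<bar>f x\<bar> + (x powr (Re s0 - 1) * x powr (-r)) * \<bar>f x\<bar>"
          by (simp add: algebra_simps)
        also have "\<dots> = W x"
          using True by (simp add: W_def abs_mult powr_add[symmetric] algebra_simps)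
        finally show ?thesis using True by simp
      qed (auto simp: W_def)
      have T_le: "(\<Sum>k<n. norm (T k x)) \<le> W x" for n x
        using sum_le_suminf[OF sums_summable[OF sums_T[of x]], of "{..<n}"] sums_unique[OF sums_T[of x]] le_W[of x]
        by auto
      have T_int: "integrable lborel (T k)" for k
      proof (rule Bochner_Integration.integrable_bound[OF W_int])
        show "AE x in lborel. norm (T k x) \<le> norm (W x)"
        proof (rule AE_I2)
          fix x
          have "norm (T k x) \<le> (\<Sum>k<Suc k. norm (T k x))" by (simp add: sum_nonneg)
          also have "\<dots> \<le> W x" by (rule T_le)
          finally show "norm (T k x) \<le> norm (W x)" by simp
        qed
      qed measurable
      have "(\<lambda>k. integral\<^sup>L lborel (T k)) sums (LINT x|lborel. (\<Sum>k. T k x))"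
      proof (rule sums_integral)
        show "AE x in lborel. summable (\<lambda>k. norm (T k x))"
          using sums_T by (auto simp: sums_iff)
        show "summable (\<lambda>k. LINT x|lborel. norm (T k x))"
        proof (rule summableI_nonneg_bounded)
          fix n
          have "(\<Sum>k<n. LINT x|lborel. norm (T k x)) = (LINT x|lborel. (\<Sum>k<n. norm (T k x)))"
            using T_int by (subst Bochner_Integration.integral_sum) auto
          also have "\<dots> \<le> (LINT x|lborel. W x)"
            using T_int W_int T_le by (intro integral_mono) auto
          finally show "(\<Sum>k<n. LINT x|lborel. norm (T k x)) \<le> (LINT x|lborel. W x)" .
        qed (use T_int in auto)
      qed (use T_int in auto)
      also have "(\<lambda>k. integral\<^sup>L lborel (T k)) = (\<lambda>k. c k * d ^ k)"
      proof
        fix k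
        have "c k * d ^ k = (LINT x|lborel. (indicator {0<..} x *\<^sub>R (of_real x powr (s0 - 1) * complex_of_real (f x)
                          * of_real (ln x) ^ k / fact k)) * d ^ k)"
          unfolding c_def set_lebesgue_integral_def by (rule integral_mult_left_zero[symmetric])
        also have "\<dots> = integral\<^sup>L lborel (T k)"
          unfolding T_def by (intro Bochner_Integration.integral_cong) auto
        finally show "integral\<^sup>L lborel (T k) = c k * d ^ k" ..
      qed
      also have "(\<lambda>x. (\<Sum>k. T k x)) = (\<lambda>x. indicator {0<..} x *\<^sub>R (of_real x powr (w - 1) * complex_of_real (f x)))"
      proof
        fix x :: real
        have "(\<lambda>k. indicator {0<..} x *\<^sub>R (of_real x powr (s0 - 1) * complex_of_real (f x) *
                 ((of_real (ln x) * d) ^ k /\<^sub>R fact k))) sums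
              (indicator {0<..} x *\<^sub>R (of_real x powr (s0 - 1) * complex_of_real (f x) * exp (of_real (ln x) * d)))"
          by (intro sums_mult sums_scaleR_right exp_converges)
        also have "(\<lambda>k. indicator {0<..} x *\<^sub>R (of_real x powr (s0 - 1) * complex_of_real (f x) *
                 ((of_real (ln x) * d) ^ k /\<^sub>R fact k))) = (\<lambda>k. T k x)"
          by (auto simp: T_def power_mult_distrib scaleR_conv_of_real field_simps)
        finally have "(\<Sum>k. T k x) = indicator {0<..} x *\<^sub>R (of_real x powr (s0 - 1) *
           complex_of_real (f x) * exp (of_real (ln x) * d))"
          by (simp add: sums_iff)
        also have "\<dots> = indicator {0<..} x *\<^sub>R (of_real x powr (w - 1) * complex_of_real (f x))"
        proof (cases "x > 0")
          case True
          have "of_real x powr (s0 - 1) * exp (of_real (ln x) * d) = (of_real x powr (w - 1) :: complex)"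
            using True by (simp add: powr_def exp_add[symmetric] d_def Ln_of_real algebra_simps)
          then show ?thesis by (simp add: mult_ac)
        qed auto
        finally show "(\<Sum>k. T k x) = indicator {0<..} x *\<^sub>R (of_real x powr (w - 1) * complex_of_real (f x))" .
      qed
      finally show ?thesis by (simp add: set_lebesgue_integral_def d_def)
    qed
    then have "(\<lambda>s. LINT x:{0<..}|lborel. of_real x powr (s - 1) * complex_of_real (f x))
           holomorphic_on ball s0 r"
      by (rule power_series_holomorphic)
    then show ?thesis using r by blast
  qed
  then have "(\<lambda>s. LINT x:{0<..}|lborel. of_real x powr (s - 1) * complex_of_real (f x))
           analytic_on {s. Re s > a}"
    unfolding analytic_on_def by auto
  then show ?thesis by (rule analytic_imp_holomorphic)
qed

section \<open>Partial fractions and Gamma integrals\<close>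

text \<open>Logarithmic differentiation of the product sinh(pi x) / (pi x) = prod (1 + x^2 / n^2):
  the logarithm turns it into the series of the \<open>f n\<close>, which is differentiated term by
  term.\<close>

lemma coth_partial_fractions:
  fixes u :: real
  assumes u: "u > 0"
  shows "(\<lambda>n. 2 * u / (u\<^sup>2 + (real (Suc n))\<^sup>2)) sums (pi * cosh (pi * u) / sinh (pi * u) - 1 / u)"
proof -
  define f where "f = (\<lambda>n x. ln (1 + x\<^sup>2 / (real (Suc n))\<^sup>2))"
  define f' where "f' = (\<lambda>n (x::real). 2 * x / (x\<^sup>2 + (real (Suc n))\<^sup>2))"
  define F where "F = (\<lambda>x. ln (sinh (pi * x) / (pi * x)))"
  have sums_F: "(\<lambda>n. f n x) sums F x" if x: "x > 0" for x
  proof -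
    \<comment> \<open>Euler's sine product at the point i x; both sides are purely imaginary there,
      and the imaginary part is the product for sinh.\<close>
    have "(\<lambda>n. Im (complex_of_real pi * (\<i> * of_real x) * (\<Prod>k=1..n. 1 - (\<i> * of_real x)\<^sup>2 / (of_nat k)\<^sup>2)))
            \<longlonglongrightarrow> Im (sin (of_real pi * (\<i> * of_real x)))"
      by (intro tendsto_Im sin_product_formula_complex)
    also have "Im (sin (of_real pi * (\<i> * of_real x))) = sinh (pi * x)"
      by (simp add: Im_sin sinh_def)
    also have "(\<lambda>n. Im (complex_of_real pi * (\<i> * of_real x) * (\<Prod>k=1..n. 1 - (\<i> * of_real x)\<^sup>2 / (of_nat k)\<^sup>2))) =
               (\<lambda>n. pi * x * (\<Prod>k=1..n. 1 + x\<^sup>2 / (real k)\<^sup>2))"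
    proof
      fix n :: nat
      have "complex_of_real pi * (\<i> * of_real x) * (\<Prod>k=1..n. 1 - (\<i> * of_real x)\<^sup>2 / (of_nat k)\<^sup>2) =
            \<i> * of_real (pi * x * (\<Prod>k=1..n. 1 + x\<^sup>2 / (real k)\<^sup>2))"
        by (simp add: power_mult_distrib mult_ac)
      then show "Im (complex_of_real pi * (\<i> * of_real x) * (\<Prod>k=1..n. 1 - (\<i> * of_real x)\<^sup>2 / (of_nat k)\<^sup>2)) =
            pi * x * (\<Prod>k=1..n. 1 + x\<^sup>2 / (real k)\<^sup>2)" by (simp only: Im_i_times Re_complex_of_real)
    qed
    finally have "(\<lambda>n. pi * x * (\<Prod>k=1..n. 1 + x\<^sup>2 / (real k)\<^sup>2) / (pi * x)) \<longlonglongrightarrow> sinh (pi * x) / (pi * x)"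
      using x by (intro tendsto_intros) auto
    then have "(\<lambda>n. \<Prod>k=1..n. 1 + x\<^sup>2 / (real k)\<^sup>2) \<longlonglongrightarrow> sinh (pi * x) / (pi * x)"
      using x by simp
    then have "(\<lambda>n. ln (\<Prod>k=1..n. 1 + x\<^sup>2 / (real k)\<^sup>2)) \<longlonglongrightarrow> F x"
      unfolding F_def using x by (intro tendsto_ln) auto
    also have "(\<lambda>n. ln (\<Prod>k=1..n. 1 + x\<^sup>2 / (real k)\<^sup>2)) = (\<lambda>n. \<Sum>i<n. f i x)"
    proof
      fix n :: nat
      have "ln (\<Prod>k=1..n. 1 + x\<^sup>2 / (real k)\<^sup>2) = (\<Sum>k=1..n. ln (1 + x\<^sup>2 / (real k)\<^sup>2))"
      proof (intro ln_prod)
        have "1 + x\<^sup>2 / (real k)\<^sup>2 > 0" for k by (intro add_pos_nonneg) auto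
        then show "1 + x\<^sup>2 / (real k)\<^sup>2 \<noteq> 0" for k by (metis less_irrefl)
      qed auto
      also have "\<dots> = (\<Sum>i<n. f i x)"
        unfolding f_def by (rule sum.reindex_bij_witness[of _ Suc "\<lambda>k. k - 1"]) auto
      finally show "ln (\<Prod>k=1..n. 1 + x\<^sup>2 / (real k)\<^sup>2) = (\<Sum>i<n. f i x)" .
    qed
    finally show ?thesis by (simp add: sums_def)
  qed
  \<comment> \<open>A bounded interval around \<open>u\<close>: the derivatives \<open>f' n\<close>
    are at most 2 (u + 1) / n^2 on it (with n shifted by one), which gives uniform
    convergence.\<close>
  define S where "S = {0<..<u + 1}"
  have bound: "norm (f' n x) \<le> 2 * (u + 1) * (1 / (real (Suc n))\<^sup>2)" if "x \<in> S" for n x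
  proof -
    have "2 * x / (x\<^sup>2 + (real (Suc n))\<^sup>2) \<le> 2 * (u + 1) / (real (Suc n))\<^sup>2"
      using that u by (intro frac_le) (auto simp: S_def)
    then show ?thesis using that by (simp add: f'_def S_def)
  qed
  have summ: "summable (\<lambda>n. 2 * (u + 1) * (1 / (real (Suc n))\<^sup>2))"
    using inverse_squares_sums by (intro summable_mult) (auto simp: sums_iff add_ac)
  have unif: "uniformly_convergent_on S (\<lambda>n x. \<Sum>i<n. f' i x)"
    by (rule Weierstrass_m_test'[OF bound summ])
  have "((\<lambda>x. \<Sum>n. f n x) has_field_derivative (\<Sum>n. f' n u)) (at u)"
  proof (rule has_field_derivative_series'(2)[where S = S and f = f and f' = f' and ?x0.0 = u])
    show "(f n has_field_derivative f' n x) (at x within S)" for n x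
    proof -
      define m where "m = real (Suc n)"
      have m: "m > 0" and pos: "1 + x\<^sup>2 / m\<^sup>2 > 0"
        unfolding m_def by (simp, intro add_pos_nonneg) auto
      have "((\<lambda>x. ln (1 + x\<^sup>2 * c)) has_field_derivative (2 * x * c) / (1 + x\<^sup>2 * c)) (at x within S)"
        if "1 + x\<^sup>2 * c > 0" for c
        using that by (auto intro!: derivative_eq_intros)
      from this[of "1 / m\<^sup>2"] pos
      have "((\<lambda>x. ln (1 + x\<^sup>2 / m\<^sup>2)) has_field_derivative (2 * x / m\<^sup>2) / (1 + x\<^sup>2 / m\<^sup>2)) (at x within S)"
        by simp
      also have "1 + x\<^sup>2 / m\<^sup>2 = (x\<^sup>2 + m\<^sup>2) / m\<^sup>2"
        using m by (simp add: field_simps)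
      also have "(2 * x / m\<^sup>2) / ((x\<^sup>2 + m\<^sup>2) / m\<^sup>2) = 2 * x / (x\<^sup>2 + m\<^sup>2)"
        using m by simp
      finally show ?thesis unfolding f_def f'_def m_def .
    qed
  qed (use unif sums_F[OF u] u in \<open>auto simp: S_def sums_iff\<close>)
  \<comment> \<open>The series was identified with \<open>F\<close> only for positive arguments, so
    the derivative is transferred through a neighbourhood of \<open>u\<close>.\<close>
  moreover have "eventually (\<lambda>x. (\<Sum>n. f n x) = F x) (nhds u)"
    using eventually_nhds_in_open[of "{0<..}" u] u sums_F
    by (auto elim!: eventually_mono simp: sums_iff)
  ultimately have "(F has_field_derivative (\<Sum>n. f' n u)) (at u)"
    by (subst (asm) DERIV_cong_ev[OF refl _ refl])
  moreover have "(F has_field_derivative (pi * cosh (pi * u) / sinh (pi * u) - 1 / u)) (at u)"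
  proof -
    have "sinh (pi * u) > 0" using u by simp
    then show ?thesis using u unfolding F_def
      by (auto intro!: derivative_eq_intros simp: field_simps power2_eq_square)
  qed
  ultimately have "(\<Sum>n. f' n u) = pi * cosh (pi * u) / sinh (pi * u) - 1 / u"
    by (rule DERIV_unique)
  moreover have "summable (\<lambda>n. f' n u)"
    by (rule summable_comparison_test'[OF summ, of 0]) (use bound[of u] u in \<open>auto simp: S_def\<close>)
  ultimately show ?thesis by (simp add: sums_iff f'_def)
qed

text \<open>The preceding expansion at u = x / (2 pi), rewritten by coth(x / 2) = 1 + 2 / (e^x -
  1).\<close>

lemma bose_partial_fractions:
  fixes x :: real
  assumes x: "x > 0"
  shows "(\<lambda>n. 2 * x / (x\<^sup>2 + (2 * pi * real (Suc n))\<^sup>2)) sums (1 / (exp x - 1) - 1 / x + 1 / 2)"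
proof -
  define u where "u = x / (2 * pi)"
  have u: "u > 0" and xu: "x = 2 * pi * u" using x by (auto simp: u_def)
  have "(\<lambda>n. 1 / (2 * pi) * (2 * u / (u\<^sup>2 + (real (Suc n))\<^sup>2))) sums
          (1 / (2 * pi) * (pi * cosh (pi * u) / sinh (pi * u) - 1 / u))"
    by (intro sums_mult coth_partial_fractions u)
  also have "(\<lambda>n. 1 / (2 * pi) * (2 * u / (u\<^sup>2 + (real (Suc n))\<^sup>2))) =
             (\<lambda>n. 2 * x / (x\<^sup>2 + (2 * pi * real (Suc n))\<^sup>2))"
  proof
    fix n
    define d where "d = u\<^sup>2 + (real (Suc n))\<^sup>2"
    have "d > 0" unfolding d_def using u by (intro add_pos_nonneg) auto
    moreover have "x\<^sup>2 + (2 * pi * real (Suc n))\<^sup>2 = (2 * pi)\<^sup>2 * d"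
      unfolding xu power_mult_distrib d_def by (simp add: algebra_simps)
    ultimately show "1 / (2 * pi) * (2 * u / (u\<^sup>2 + (real (Suc n))\<^sup>2)) =
        2 * x / (x\<^sup>2 + (2 * pi * real (Suc n))\<^sup>2)"
      unfolding d_def[symmetric] by (simp add: xu field_simps power2_eq_square)
  qed
  also have "1 / (2 * pi) * (pi * cosh (pi * u) / sinh (pi * u) - 1 / u) = 1 / (exp x - 1) - 1 / x + 1 / 2"
  proof -
    define t where "t = exp (pi * u)"
    have t: "t > 1" using u by (simp add: t_def)
    have e: "exp x = t\<^sup>2" unfolding xu t_def by (simp add: power2_eq_square flip: exp_add)
    have t2: "t\<^sup>2 > 1" using t by (simp add: power2_eq_square less_1_mult)
    have half: "(p / 2) / (q / 2) = p / q" for p q :: real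
      by simp
    have "cosh (pi * u) = (t + 1 / t) / 2" "sinh (pi * u) = (t - 1 / t) / 2"
      by (simp_all add: t_def cosh_def sinh_def exp_minus inverse_eq_divide)
    then have "cosh (pi * u) / sinh (pi * u) = ((t + 1 / t) / 2) / ((t - 1 / t) / 2)"
      by (simp only:)
    also have "\<dots> = (t + 1 / t) / (t - 1 / t)"
      using half .
    also have "t + 1 / t = (t\<^sup>2 + 1) / t"
      using t by (simp add: field_simps power2_eq_square)
    also have "t - 1 / t = (t\<^sup>2 - 1) / t"
      using t by (simp add: field_simps power2_eq_square)
    also have "(t\<^sup>2 + 1) / t / ((t\<^sup>2 - 1) / t) = 1 + 2 / (t\<^sup>2 - 1)"
    proof -
      define d where "d = t\<^sup>2 - 1"
      have "d > 0" "t\<^sup>2 + 1 = d + 2" using t2 unfolding d_def by linarith+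
      then show ?thesis unfolding d_def[symmetric] using t by (simp add: field_simps)
    qed
    finally have c: "cosh (pi * u) / sinh (pi * u) = 1 + 2 / (t\<^sup>2 - 1)" .
    have "1 / (2 * pi) * (pi * cosh (pi * u) / sinh (pi * u) - 1 / u) =
          cosh (pi * u) / sinh (pi * u) / 2 - 1 / (2 * pi * u)"
      using u by (simp add: right_diff_distrib)
    then show ?thesis unfolding c e xu[symmetric] by simp
  qed
  finally show ?thesis .
qed

text \<open>For nonnegative terms, summability of the integrals is already absolute convergence, so
  sum and integral may be exchanged. It serves both the geometric series and the partial fractions
  of 1 / (e^x - 1).\<close>

lemma has_bochner_integral_suminf_nonneg:
  fixes f :: "nat \<Rightarrow> 'a \<Rightarrow> real"
  assumes "\<And>n. has_bochner_integral M (f n) (c n)"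
    and "\<And>n x. f n x \<ge> 0"
    and "summable c"
    and "\<And>x. (\<lambda>n. f n x) sums F x"
  shows "has_bochner_integral M F (suminf c)"
proof -
  have F: "F = (\<lambda>x. \<Sum>n. f n x)" using assms(4) by (auto simp: sums_iff)
  have int: "integrable M (f n)" "integral\<^sup>L M (f n) = c n" for n
    using assms(1)[of n] by (auto simp: has_bochner_integral_iff)
  have s: "AE x in M. summable (\<lambda>n. norm (f n x))"
    using assms(2,4) by (auto simp: sums_iff)
  have s2: "summable (\<lambda>n. LINT x|M. norm (f n x))"
    using assms(2,3) int by simp
  show ?thesis unfolding F
    using integrable_suminf[OF int(1) s s2] integral_suminf[OF int(1) s s2] int(2)
    by (simp add: has_bochner_integral_iff)
qed

text \<open>Linear substitution in Euler's integral. The nonnegative integral is used so that the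
  formula can be applied inside a Tonelli exchange, before any integrability is known.\<close>

lemma nn_integral_Gamma_scaled:
  fixes s c :: real
  assumes s: "s > 0" and c: "c > 0"
  shows "(\<integral>\<^sup>+x. ennreal (indicator {0<..} x * (x powr (s - 1) * exp (- c * x))) \<partial>lborel)
           = ennreal (Gamma s * c powr (- s))"
proof -
  let ?I = "\<integral>\<^sup>+x. ennreal (indicator {0<..} x * (x powr (s - 1) * exp (- c * x))) \<partial>lborel"
  have "ennreal (Gamma s) = (\<integral>\<^sup>+x. ennreal (indicator {0<..} x * (x powr (s - 1) * exp (- x))) \<partial>lborel)"
    unfolding Gamma_conv_nn_integral_real[OF s]
    by (intro nn_integral_cong) (auto simp: indicator_def exp_minus divide_inverse)
  also have "\<dots> = ennreal \<bar>c\<bar> * (\<integral>\<^sup>+x. ennreal (indicator {0<..} (0 + c * x) *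
                     ((0 + c * x) powr (s - 1) * exp (- (0 + c * x)))) \<partial>lborel)"
    using c by (intro nn_integral_real_affine) auto
  also have "(\<integral>\<^sup>+x. ennreal (indicator {0<..} (0 + c * x) *
                     ((0 + c * x) powr (s - 1) * exp (- (0 + c * x)))) \<partial>lborel) =
             (\<integral>\<^sup>+x. ennreal (c powr (s - 1)) *
                ennreal (indicator {0<..} x * (x powr (s - 1) * exp (- c * x))) \<partial>lborel)"
    using c by (intro nn_integral_cong)
      (auto simp: indicator_def powr_mult zero_less_mult_iff mult_ac simp flip: ennreal_mult')
  also have "\<dots> = ennreal (c powr (s - 1)) * ?I"
    by (intro nn_integral_cmult) auto
  also have "ennreal \<bar>c\<bar> * (ennreal (c powr (s - 1)) * ?I) = ennreal (c powr s) * ?I"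
    using c by (simp add: mult.assoc[symmetric] powr_mult_base flip: ennreal_mult')
  finally have "ennreal (c powr (-s)) * ennreal (Gamma s) = (ennreal (c powr (-s)) * ennreal (c powr s)) * ?I"
    by (simp add: mult.assoc)
  also have "ennreal (c powr (-s)) * ennreal (c powr s) = 1"
    using c by (simp add: powr_minus flip: ennreal_mult')
  finally show ?thesis using Gamma_real_pos[OF s] by (simp add: mult.commute flip: ennreal_mult')
qed

lemma has_bochner_integral_Gamma_scaled:
  fixes s c :: real
  assumes s: "s > 0" and c: "c > 0"
  shows "has_bochner_integral lborel (\<lambda>x. indicator {0<..} x * (x powr (s - 1) * exp (- c * x)))
           (Gamma s * c powr (- s))"
  using nn_integral_Gamma_scaled[OF assms] Gamma_real_pos[OF s]
  by (intro has_bochner_integral_nn_integral) auto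

text \<open>Writing 1 / (1 + v) as the integral of exp(-(1 + v) y) over y > 0 and exchanging the
  order, the v-integral is Gamma(a) y^(-a) and the remaining y-integral is Gamma(1 - a). The factor
  \<open>y powr (1 - 1)\<close> is 1 for y > 0; it casts the inner integral as a Gamma integral with
  exponent 1.\<close>

lemma has_bochner_integral_Gamma_reflection:
  fixes a :: real
  assumes a: "0 < a" "a < 1"
  shows "has_bochner_integral lborel (\<lambda>v. indicator {0<..} v * (v powr (a - 1) / (1 + v))) (Gamma a * Gamma (1 - a))"
proof (rule has_bochner_integral_nn_integral)
  have "(\<integral>\<^sup>+v. ennreal (indicator {0<..} v * (v powr (a - 1) / (1 + v))) \<partial>lborel) =
        (\<integral>\<^sup>+v. (\<integral>\<^sup>+y. ennreal (indicator {0<..} v * v powr (a - 1)) *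
            ennreal (indicator {0<..} y * (y powr (1 - 1) * exp (- (1 + v) * y))) \<partial>lborel) \<partial>lborel)"
  proof (intro nn_integral_cong)
    fix v :: real
    show "ennreal (indicator {0<..} v * (v powr (a - 1) / (1 + v))) =
       (\<integral>\<^sup>+y. ennreal (indicator {0<..} v * v powr (a - 1)) *
            ennreal (indicator {0<..} y * (y powr (1 - 1) * exp (- (1 + v) * y))) \<partial>lborel)"
    proof (cases "v > 0")
      case True
      then show ?thesis
        by (subst nn_integral_cmult, simp, subst nn_integral_Gamma_scaled)
           (auto simp: powr_minus divide_inverse simp flip: ennreal_mult')
    qed auto
  qed
  also have "\<dots> = (\<integral>\<^sup>+y. (\<integral>\<^sup>+v. ennreal (indicator {0<..} v * v powr (a - 1)) *
            ennreal (indicator {0<..} y * (y powr (1 - 1) * exp (- (1 + v) * y))) \<partial>lborel) \<partial>lborel)"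
    by (rule lborel_pair.Fubini') measurable
  also have "\<dots> = (\<integral>\<^sup>+y. ennreal (Gamma a) * ennreal (indicator {0<..} y * (y powr ((1 - a) - 1) * exp (- 1 * y))) \<partial>lborel)"
  proof (intro nn_integral_cong)
    fix y :: real
    show "(\<integral>\<^sup>+v. ennreal (indicator {0<..} v * v powr (a - 1)) *
            ennreal (indicator {0<..} y * (y powr (1 - 1) * exp (- (1 + v) * y))) \<partial>lborel) =
          ennreal (Gamma a) * ennreal (indicator {0<..} y * (y powr ((1 - a) - 1) * exp (- 1 * y)))"
    proof (cases "y > 0")
      case True
      have "(\<integral>\<^sup>+v. ennreal (indicator {0<..} v * v powr (a - 1)) *
            ennreal (indicator {0<..} y * (y powr (1 - 1) * exp (- (1 + v) * y))) \<partial>lborel) =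
            (\<integral>\<^sup>+v. ennreal (exp (- y)) * ennreal (indicator {0<..} v * (v powr (a - 1) * exp (- y * v))) \<partial>lborel)"
        using True by (intro nn_integral_cong)
          (auto simp: indicator_def algebra_simps exp_diff exp_minus divide_inverse simp flip: ennreal_mult')
      also have "\<dots> = ennreal (exp (- y)) * ennreal (Gamma a * y powr (- a))"
        using True a by (subst nn_integral_cmult, simp, subst nn_integral_Gamma_scaled) auto
      finally show ?thesis using True Gamma_real_pos[OF a(1)] by (simp add: mult_ac flip: ennreal_mult')
    qed auto
  qed
  also have "\<dots> = ennreal (Gamma a) * ennreal (Gamma (1 - a))"
    using a by (subst nn_integral_cmult, simp, subst nn_integral_Gamma_scaled) auto
  finally show "(\<integral>\<^sup>+v. ennreal (indicator {0<..} v * (v powr (a - 1) / (1 + v))) \<partial>lborel) =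
       ennreal (Gamma a * Gamma (1 - a))"
    using Gamma_real_pos[of a] Gamma_real_pos[of "1 - a"] a by (simp flip: ennreal_mult')
qed (use Gamma_real_pos[of a] Gamma_real_pos[of "1 - a"] a in \<open>auto simp: indicator_def\<close>)

lemma has_bochner_integral_subst_sqrt:
  fixes f :: "real \<Rightarrow> real"
  assumes f: "\<And>x. x > 0 \<Longrightarrow> isCont f x" "\<And>x. x > 0 \<Longrightarrow> f x \<ge> 0"
    and int: "has_bochner_integral lborel (\<lambda>v. indicator {0<..} v * (f (sqrt v) / (2 * sqrt v))) I"
  shows "has_bochner_integral lborel (\<lambda>u. indicator {0<..} u * f u) I"
proof -
  have e: "einterval 0 \<infinity> = {0<..}" by (auto simp: einterval_def)
  have 1: "((ereal \<circ> sqrt \<circ> real_of_ereal) \<longlongrightarrow> 0) (at_right 0)"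
    unfolding zero_ereal_def ereal_tendsto_simps
    using tendsto_real_sqrt[OF tendsto_ident_at[of 0 "{0<..}"]] by simp
  have 2: "((ereal \<circ> sqrt \<circ> real_of_ereal) \<longlongrightarrow> \<infinity>) (at_left \<infinity>)"
    unfolding ereal_tendsto_simps by (rule sqrt_at_top)
  have i: "set_integrable lborel (einterval 0 \<infinity>) (\<lambda>v. f (sqrt v) * (inverse (sqrt v) / 2))"
    using int unfolding has_bochner_integral_iff e set_integrable_def by (simp add: field_simps)
  note * = interval_integral_substitution_nonneg[where f = f and g = sqrt and a = 0 and b = \<infinity> and
      A = 0 and B = \<infinity> and g' = "\<lambda>v. inverse (sqrt v) / 2", OF _ _ _ _ _ _ 1 2 i]
  have "set_integrable lborel {0<..} f"
    unfolding e[symmetric]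
    by (rule *(1)) (use f in \<open>auto intro!: DERIV_real_sqrt continuous_intros\<close>)
  moreover have "(LBINT x=0..\<infinity>. f x) = (LBINT x=0..\<infinity>. (f (sqrt x) * (inverse (sqrt x) / 2)))"
    by (rule *(2)) (use f in \<open>auto intro!: DERIV_real_sqrt continuous_intros\<close>)
  ultimately show ?thesis
    using int
    by (simp add: has_bochner_integral_iff set_integrable_def interval_lebesgue_integral_def e
          set_lebesgue_integral_def field_simps)
qed

text \<open>With v = u^2 this is half of the previous Beta-type integral at a = (1 + s) / 2, and the
  reflection formula evaluates it, as sin(pi a) = cos(pi s / 2).\<close>

lemma has_bochner_integral_powr_over_one_plus_square:
  fixes s :: real
  assumes s: "-1 < s" "s < 1"
  shows "has_bochner_integral lborel (\<lambda>u. indicator {0<..} u * (u powr s / (1 + u\<^sup>2))) (pi / (2 * cos (pi * s / 2)))"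
proof (rule has_bochner_integral_subst_sqrt)
  let ?a = "(1 + s) / 2"
  have "complex_of_real (Gamma ?a * Gamma (1 - ?a)) = of_real (pi / sin (pi * ?a))"
    using Gamma_reflection_complex[of "of_real ?a"]
    by (simp only: of_real_mult of_real_divide flip: sin_of_real Gamma_complex_of_real) simp
  then have G: "Gamma ?a * Gamma (1 - ?a) = pi / sin (pi * ?a)"
    by (simp only: of_real_eq_iff)
  also have "pi * ?a = pi / 2 + pi * s / 2"
    by (simp add: field_simps)
  also have "sin (pi / 2 + pi * s / 2) = cos (pi * s / 2)"
    by (simp add: sin_add)
  finally have "has_bochner_integral lborel (\<lambda>v. 1 / 2 * (indicator {0<..} v * (v powr (?a - 1) / (1 + v))))
           (1 / 2 * (pi / cos (pi * s / 2)))"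
    using has_bochner_integral_Gamma_reflection[of ?a] s
    by (intro has_bochner_integral_mult_right) auto
  also have "(\<lambda>v. 1 / 2 * (indicator {0<..} v * (v powr (?a - 1) / (1 + v)))) =
       (\<lambda>v. indicator {0<..} v * (sqrt v powr s / (1 + (sqrt v)\<^sup>2) / (2 * sqrt v)))"
  proof
    fix v :: real
    have "v powr (?a - 1) = sqrt v powr s / sqrt v" if v: "v > 0"
      using v unfolding powr_half_sqrt[symmetric, OF less_imp_le[OF v]] powr_powr powr_diff[symmetric]
      by (intro arg_cong2[where f = "(powr)"]) (auto simp: field_simps)
    then show "1 / 2 * (indicator {0<..} v * (v powr (?a - 1) / (1 + v))) =
        indicator {0<..} v * (sqrt v powr s / (1 + (sqrt v)\<^sup>2) / (2 * sqrt v))"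
      by (auto simp: indicator_def)
  qed
  finally show "has_bochner_integral lborel (\<lambda>v. indicator {0<..} v * (sqrt v powr s / (1 + (sqrt v)\<^sup>2) / (2 * sqrt v)))
     (pi / (2 * cos (pi * s / 2)))" by simp
next
  fix x :: real assume x: "x > 0"
  then have "1 + x\<^sup>2 \<noteq> 0" by (smt (verit) zero_le_power2)
  with x show "isCont (\<lambda>x. x powr s / (1 + x\<^sup>2)) x" by (auto intro!: continuous_intros)
qed auto

section \<open>Mellin integrals of 1 / (e^x - 1) and of its regularisation\<close>

lemma summable_Suc_powr: "summable (\<lambda>n. real (Suc n) powr s)" if "s < -1"
  using that summable_Suc_iff[of "\<lambda>n. real n powr s"] summable_real_powr_iff[of s] by simp

lemma has_bochner_integral_powr_unit_interval:
  fixes p :: real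
  assumes p: "p > -1"
  shows "has_bochner_integral lborel (\<lambda>x. indicator {0<..<1} x * x powr p) (1 / (p + 1))"
proof (rule has_bochner_integral_nn_integral)
  have "(\<integral>\<^sup>+ x. ennreal (indicator {0..1} x * x powr p) \<partial>lborel) = ennreal (1 / (p + 1))"
    using nn_integral_has_integral_lebesgue[OF _ has_integral_powr_from_0[OF p, of 1]] by simp
  also have "(\<integral>\<^sup>+ x. ennreal (indicator {0..1} x * x powr p) \<partial>lborel) =
             (\<integral>\<^sup>+ x. ennreal (indicator {0<..<1} x * x powr p) \<partial>lborel)"
  proof (rule nn_integral_cong_AE)
    show "AE x in lborel. ennreal (indicator {0..1} x * x powr p) = ennreal (indicator {0<..<1} x * x powr p)"
      using AE_lborel_singleton[of "0::real"] AE_lborel_singleton[of "1::real"]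
      by eventually_elim (auto simp: indicator_def)
  qed
  finally show "(\<integral>\<^sup>+ x. ennreal (indicator {0<..<1} x * x powr p) \<partial>lborel) = ennreal (1 / (p + 1))" .
qed (use p in auto)

lemma has_bochner_integral_powr_atLeast_1:
  fixes p :: real
  assumes p: "p < -1"
  shows "has_bochner_integral lborel (\<lambda>x. indicator {1..} x * x powr p) (- 1 / (p + 1))"
proof (rule has_bochner_integral_nn_integral)
  show "(\<integral>\<^sup>+ x. ennreal (indicator {1..} x * x powr p) \<partial>lborel) = ennreal (- 1 / (p + 1))"
    using nn_integral_has_integral_lebesgue[OF _ has_integral_powr_to_inf[OF p, of 1]] by simp
qed (use p in \<open>auto simp: field_simps\<close>)

lemma has_bochner_integral_bose:
  fixes s :: real
  assumes s: "s > 1"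
  shows "has_bochner_integral lborel (\<lambda>x. indicator {0<..} x * (x powr (s - 1) / (exp x - 1)))
           (Gamma s * (\<Sum>n. real (Suc n) powr (- s)))"
proof -
  have summ: "summable (\<lambda>n. real (Suc n) powr (- s))"
    using s by (intro summable_Suc_powr) auto
  have "has_bochner_integral lborel (\<lambda>x. indicator {0<..} x * (x powr (s - 1) / (exp x - 1)))
          (\<Sum>n. Gamma s * real (Suc n) powr (- s))"
  proof (rule has_bochner_integral_suminf_nonneg)
    show "has_bochner_integral lborel (\<lambda>x. indicator {0<..} x * (x powr (s - 1) * exp (- real (Suc n) * x)))
            (Gamma s * real (Suc n) powr (- s))" for n
      using s by (intro has_bochner_integral_Gamma_scaled) auto
    show "summable (\<lambda>n. Gamma s * real (Suc n) powr (- s))"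
      by (intro summable_mult summ)
    fix x :: real
    show "(\<lambda>n. indicator {0<..} x * (x powr (s - 1) * exp (- real (Suc n) * x))) sums
            (indicator {0<..} x * (x powr (s - 1) / (exp x - 1)))"
    proof (cases "x > 0")
      case True
      have "(\<lambda>n. exp (-x) * exp (-x) ^ n) sums (exp (-x) * (1 / (1 - exp (-x))))"
        using True by (intro sums_mult geometric_sums) auto
      also have "(\<lambda>n. exp (-x) * exp (-x) ^ n) = (\<lambda>n. exp (- real (Suc n) * x))"
        by (simp add: exp_of_nat_mult[symmetric] exp_add[symmetric] algebra_simps)
      also have "exp (-x) * (1 / (1 - exp (-x))) = 1 / (exp x - 1)"
        using True by (simp add: exp_minus field_simps)
      finally have "(\<lambda>n. indicator {0<..} x * (x powr (s - 1) * exp (- real (Suc n) * x))) sums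
            (indicator {0<..} x * (x powr (s - 1) * (1 / (exp x - 1))))"
        by (intro sums_mult)
      then show ?thesis by simp
    qed auto
  qed auto
  then show ?thesis by (simp only: suminf_mult[OF summ])
qed

text \<open>The substitution u = x / c in the integral of u^s / (1 + u^2). For c = 2 pi k it treats
  the k-th partial fraction of 1 / (e^x - 1) - 1 / x + 1 / 2.\<close>

lemma has_bochner_integral_powr_over_sum_squares:
  fixes s c :: real
  assumes s: "-1 < s" "s < 1" and c: "c > 0"
  shows "has_bochner_integral lborel (\<lambda>x. indicator {0<..} x * (x powr (s - 1) * (2 * x / (x\<^sup>2 + c\<^sup>2))))
           (c powr (s - 1) * pi / cos (pi * s / 2))"
proof -
  let ?f = "\<lambda>u::real. indicator {0<..} u * (u powr s / (1 + u\<^sup>2))"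
  have "has_bochner_integral lborel ?f (pi / (2 * cos (pi * s / 2)))"
    by (rule has_bochner_integral_powr_over_one_plus_square[OF s])
  then have "has_bochner_integral lborel (\<lambda>x. ?f (0 + (1 / c) * x)) ((pi / (2 * cos (pi * s / 2))) /\<^sub>R \<bar>1 / c\<bar>)"
    using c by (subst (asm) lborel_has_bochner_integral_real_affine_iff[of "1 / c" _ _ 0]) auto
  then have "has_bochner_integral lborel (\<lambda>x. 2 * c powr (s - 2) * ?f (0 + (1 / c) * x))
               (2 * c powr (s - 2) * ((pi / (2 * cos (pi * s / 2))) /\<^sub>R \<bar>1 / c\<bar>))"
    by (rule has_bochner_integral_mult_right)
  also have "2 * c powr (s - 2) * ((pi / (2 * cos (pi * s / 2))) /\<^sub>R \<bar>1 / c\<bar>) =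
             (c powr (s - 2) * c) * (pi / cos (pi * s / 2))"
    using c by simp
  also have "c powr (s - 2) * c = c powr (s - 1)"
    using c powr_add[of c "s - 2" 1] by simp
  also have "(\<lambda>x. 2 * c powr (s - 2) * ?f (0 + (1 / c) * x)) =
             (\<lambda>x. indicator {0<..} x * (x powr (s - 1) * (2 * x / (x\<^sup>2 + c\<^sup>2))))"
  proof
    fix x :: real
    show "2 * c powr (s - 2) * ?f (0 + (1 / c) * x) =
          indicator {0<..} x * (x powr (s - 1) * (2 * x / (x\<^sup>2 + c\<^sup>2)))"
    proof (cases "x > 0")
      case True
      have "x powr s = x powr (s - 1) * x"
        using True powr_add[of x "s - 1" 1] by simp
      moreover have "c powr s = c powr (s - 2) * c\<^sup>2"
        using c powr_add[of c "s - 2" 2] by simp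
      moreover have "1 + (x / c)\<^sup>2 = (x\<^sup>2 + c\<^sup>2) / c\<^sup>2"
        using c by (simp add: field_simps)
      ultimately show ?thesis using True c
        by (simp add: powr_divide)
    qed (use c in \<open>auto simp: indicator_def zero_less_divide_iff\<close>)
  qed
  finally show ?thesis by simp
qed

text \<open>At 0, 1 / (e^x - 1) behaves like 1 / x - 1 / 2 + O(x). Subtracting the first two terms
  only below 1 gains convergence at 0 without losing the exponential decay at infinity.\<close>

definition bose_reg :: "real \<Rightarrow> real" where
  "bose_reg x = 1 / (exp x - 1) - (if x < 1 then 1 / x - 1 / 2 else 0)"

lemma borel_measurable_bose_reg [measurable]: "bose_reg \<in> borel_measurable borel"
  unfolding bose_reg_def by measurable

text \<open>For s > 1 the subtracted terms are integrable on (0, 1), with integrals 1 / (s - 1) and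
  1 / (2 s).\<close>

lemma has_bochner_integral_bose_reg_gt_1:
  fixes s :: real
  assumes s: "s > 1"
  shows "has_bochner_integral lborel (\<lambda>x. indicator {0<..} x * (x powr (s - 1) * bose_reg x))
           (Gamma s * (\<Sum>n. real (Suc n) powr (- s)) - 1 / (s - 1) + 1 / (2 * s))"
proof -
  have "has_bochner_integral lborel
          (\<lambda>x. indicator {0<..} x * (x powr (s - 1) / (exp x - 1)) - indicator {0<..<1} x * x powr (s - 2)
               + 1 / 2 * (indicator {0<..<1} x * x powr (s - 1)))
          (Gamma s * (\<Sum>n. real (Suc n) powr (- s)) - 1 / ((s - 2) + 1) + 1 / 2 * (1 / ((s - 1) + 1)))"
    using s by (intro has_bochner_integral_add has_bochner_integral_diff has_bochner_integral_mult_right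
                  has_bochner_integral_bose has_bochner_integral_powr_unit_interval) auto
  also have "(\<lambda>x. indicator {0<..} x * (x powr (s - 1) / (exp x - 1)) - indicator {0<..<1} x * x powr (s - 2)
               + 1 / 2 * (indicator {0<..<1} x * x powr (s - 1))) =
             (\<lambda>x. indicator {0<..} x * (x powr (s - 1) * bose_reg x))"
  proof
    fix x :: real
    have "x powr (s - 2) = x powr (s - 1) / x" if "x > 0"
      using that powr_diff[of x "s - 1" 1] by simp
    then show "indicator {0<..} x * (x powr (s - 1) / (exp x - 1)) - indicator {0<..<1} x * x powr (s - 2)
               + 1 / 2 * (indicator {0<..<1} x * x powr (s - 1)) =
               indicator {0<..} x * (x powr (s - 1) * bose_reg x)"
      by (auto simp: indicator_def bose_reg_def algebra_simps)
  qed
  finally show ?thesis by (simp add: mult.commute)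
qed

text \<open>For s < 0 the terms 1 / x - 1 / 2 are instead added back on x >= 1, where their integral
  is -1 / (s - 1) + 1 / (2 s). These are the same elementary terms as for s > 1, so both values fit
  one formula.\<close>

lemma has_bochner_integral_bose_reg_neg:
  fixes s :: real
  assumes s: "-1 < s" "s < 0"
  shows "has_bochner_integral lborel (\<lambda>x. indicator {0<..} x * (x powr (s - 1) * bose_reg x))
           ((2 * pi) powr (s - 1) * pi / cos (pi * s / 2) * (\<Sum>n. real (Suc n) powr (s - 1)) - 1 / (s - 1) + 1 / (2 * s))"
proof -
  let ?C = "(2 * pi) powr (s - 1) * pi / cos (pi * s / 2)"
  have summ: "summable (\<lambda>n. real (Suc n) powr (s - 1))"
    using s by (intro summable_Suc_powr) auto
  have factor: "(2 * pi * real (Suc n)) powr (s - 1) * pi / cos (pi * s / 2) = ?C * real (Suc n) powr (s - 1)" for n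
    by (simp add: powr_mult[of "2 * pi" "real (Suc n)"] del: of_nat_Suc)
  have "has_bochner_integral lborel (\<lambda>x. indicator {0<..} x * (x powr (s - 1) * (1 / (exp x - 1) - 1 / x + 1 / 2)))
          (\<Sum>n. (2 * pi * real (Suc n)) powr (s - 1) * pi / cos (pi * s / 2))"
  proof (rule has_bochner_integral_suminf_nonneg)
    show "has_bochner_integral lborel (\<lambda>x. indicator {0<..} x * (x powr (s - 1) * (2 * x / (x\<^sup>2 + (2 * pi * real (Suc n))\<^sup>2))))
            ((2 * pi * real (Suc n)) powr (s - 1) * pi / cos (pi * s / 2))" for n
      using s by (intro has_bochner_integral_powr_over_sum_squares) auto
    show "summable (\<lambda>n. (2 * pi * real (Suc n)) powr (s - 1) * pi / cos (pi * s / 2))"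
      unfolding factor by (intro summable_mult summ)
    fix x :: real
    show "(\<lambda>n. indicator {0<..} x * (x powr (s - 1) * (2 * x / (x\<^sup>2 + (2 * pi * real (Suc n))\<^sup>2)))) sums
            (indicator {0<..} x * (x powr (s - 1) * (1 / (exp x - 1) - 1 / x + 1 / 2)))"
    proof (cases "x > 0")
      case True
      then show ?thesis by (intro sums_mult bose_partial_fractions)
    qed auto
  qed (auto simp: indicator_def intro!: divide_nonneg_nonneg)
  also have "(\<Sum>n. (2 * pi * real (Suc n)) powr (s - 1) * pi / cos (pi * s / 2)) =
             (\<Sum>n. ?C * real (Suc n) powr (s - 1))"
    unfolding factor ..
  also have "\<dots> = ?C * (\<Sum>n. real (Suc n) powr (s - 1))"
    by (rule suminf_mult[OF summ])
  finally have "has_bochner_integral lborel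
          (\<lambda>x. indicator {0<..} x * (x powr (s - 1) * (1 / (exp x - 1) - 1 / x + 1 / 2))
               + indicator {1..} x * x powr (s - 2) - 1 / 2 * (indicator {1..} x * x powr (s - 1)))
          (?C * (\<Sum>n. real (Suc n) powr (s - 1)) + - 1 / ((s - 2) + 1) - 1 / 2 * (- 1 / ((s - 1) + 1)))"
    using s by (intro has_bochner_integral_add has_bochner_integral_diff has_bochner_integral_mult_right
                  has_bochner_integral_powr_atLeast_1) auto
  also have "(\<lambda>x. indicator {0<..} x * (x powr (s - 1) * (1 / (exp x - 1) - 1 / x + 1 / 2))
               + indicator {1..} x * x powr (s - 2) - 1 / 2 * (indicator {1..} x * x powr (s - 1))) =
             (\<lambda>x. indicator {0<..} x * (x powr (s - 1) * bose_reg x))"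
  proof
    fix x :: real
    have "x powr (s - 2) = x powr (s - 1) / x" if "x > 0"
      using that powr_diff[of x "s - 1" 1] by simp
    then show "indicator {0<..} x * (x powr (s - 1) * (1 / (exp x - 1) - 1 / x + 1 / 2))
               + indicator {1..} x * x powr (s - 2) - 1 / 2 * (indicator {1..} x * x powr (s - 1)) =
               indicator {0<..} x * (x powr (s - 1) * bose_reg x)"
      by (auto simp: indicator_def bose_reg_def algebra_simps)
  qed
  finally show ?thesis by (simp add: mult.commute)
qed

lemma set_integrable_bose_reg:
  fixes \<sigma> :: real
  assumes \<sigma>: "\<sigma> > -1"
  shows "set_integrable lborel {0<..} (\<lambda>x. x powr (\<sigma> - 1) * bose_reg x)"
proof -
  \<comment> \<open>Slope of \<open>bose_reg\<close> at 0: dropping \<open>x\<^sup>2\<close> from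
    the denominators bounds the partial fraction series by \<open>K * x\<close> for 0 < x <
    1.\<close>
  define K where "K = (\<Sum>n. 2 / (2 * pi * real (Suc n))\<^sup>2)"
  have summ: "summable (\<lambda>n. 2 / (2 * pi * real (Suc n))\<^sup>2)"
  proof -
    have "summable (\<lambda>n. 2 / (2 * pi)\<^sup>2 * (1 / (real (Suc n))\<^sup>2))"
      using inverse_squares_sums by (intro summable_mult) (auto simp: sums_iff add_ac)
    then show ?thesis by (simp add: power_mult_distrib mult.assoc del: of_nat_Suc)
  qed
  have bound: "\<bar>bose_reg x\<bar> \<le> K * x" if x: "0 < x" "x < 1" for x
  proof -
    have sums: "(\<lambda>n. 2 * x / (x\<^sup>2 + (2 * pi * real (Suc n))\<^sup>2)) sums bose_reg x"
      using bose_partial_fractions[OF x(1)] x by (simp add: bose_reg_def diff_diff_eq2 algebra_simps)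
    have "bose_reg x \<ge> 0"
      using x by (intro sums_le[OF _ sums_zero sums]) auto
    moreover have "bose_reg x \<le> K * x"
    proof (rule sums_le[OF _ sums])
      show "(\<lambda>n. 2 / (2 * pi * real (Suc n))\<^sup>2 * x) sums (K * x)"
        unfolding K_def by (intro sums_mult2 summable_sums summ)
      fix n
      have "2 * x / (x\<^sup>2 + (2 * pi * real (Suc n))\<^sup>2) \<le> 2 * x / (2 * pi * real (Suc n))\<^sup>2"
        using x by (intro divide_left_mono) (auto intro!: mult_pos_pos add_nonneg_pos)
      then show "2 * x / (x\<^sup>2 + (2 * pi * real (Suc n))\<^sup>2) \<le> 2 / (2 * pi * real (Suc n))\<^sup>2 * x"
        by simp
    qed
    ultimately show ?thesis by simp
  qed
  \<comment> \<open>The shift to \<sigma> + 3 puts the exponent above 1, where the integral of x^(s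
    - 1) / (e^x - 1) converges, and it only enlarges the power for x >= 1.\<close>
  have "integrable lborel (\<lambda>x. K * (indicator {0<..<1} x * x powr \<sigma>) +
            indicator {0<..} x * (x powr ((\<sigma> + 3) - 1) / (exp x - 1)))"
    using has_bochner_integral_powr_unit_interval[OF \<sigma>] has_bochner_integral_bose[of "\<sigma> + 3"] \<sigma>
    by (intro Bochner_Integration.integrable_add integrable_mult_right) (auto simp: has_bochner_integral_iff)
  then show ?thesis unfolding set_integrable_def
  proof (rule Bochner_Integration.integrable_bound)
    show "AE x in lborel. norm (indicator {0<..} x *\<^sub>R (x powr (\<sigma> - 1) * bose_reg x)) \<le>
        norm (K * (indicator {0<..<1} x * x powr \<sigma>) + indicator {0<..} x * (x powr ((\<sigma> + 3) - 1) / (exp x - 1)))"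
    proof (rule AE_I2)
      fix x :: real
      have K: "K \<ge> 0" unfolding K_def by (intro suminf_nonneg summ) auto
      consider "x \<le> 0" | "0 < x" "x < 1" | "x \<ge> 1" by linarith
      then show "norm (indicator {0<..} x *\<^sub>R (x powr (\<sigma> - 1) * bose_reg x)) \<le>
        norm (K * (indicator {0<..<1} x * x powr \<sigma>) + indicator {0<..} x * (x powr ((\<sigma> + 3) - 1) / (exp x - 1)))"
      proof cases
        case 2
        have "x powr (\<sigma> - 1) * \<bar>bose_reg x\<bar> \<le> x powr (\<sigma> - 1) * (K * x)"
          using bound[OF 2] by (intro mult_left_mono) auto
        also have "\<dots> = K * x powr \<sigma>"
          using 2 powr_add[of x "\<sigma> - 1" 1] by simp
        also have "\<dots> \<le> K * x powr \<sigma> + x powr (\<sigma> + 2) / (exp x - 1)"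
          using 2 by simp
        finally show ?thesis using 2 K by (simp add: abs_mult add.commute)
      next
        case 3
        have "x powr (\<sigma> - 1) * (1 / (exp x - 1)) \<le> x powr (\<sigma> + 2) * (1 / (exp x - 1))"
          using 3 by (intro mult_right_mono powr_mono) auto
        then show ?thesis using 3 by (simp add: bose_reg_def abs_mult add.commute)
      qed auto
    qed
  qed measurable
qed

section \<open>Continuation and functional equation of the zeta function\<close>

lemma norm_of_nat_Suc_powr: "norm (of_nat (Suc n) powr s :: complex) = real (Suc n) powr Re s"
proof -
  have "norm (of_real (real (Suc n)) powr s :: complex) = real (Suc n) powr Re s"
    by (subst norm_powr_real_powr) auto
  then show ?thesis by simp
qed

text \<open>The modulus of n^(-s) depends only on Re s, so convergence at the abscissa \<sigma>
  controls the whole half-plane, uniformly in Im s. This is what later bounds E in the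
  strip.\<close>

lemma dirichlet_series_summable:
  fixes c :: "nat \<Rightarrow> complex"
  assumes "summable (\<lambda>n. norm (c n) * real (Suc n) powr (- \<sigma>))" and "Re s \<ge> \<sigma>"
  shows "summable (\<lambda>n. norm (c n * of_nat (Suc n) powr (- s)))"
    and "norm (\<Sum>n. c n * of_nat (Suc n) powr (- s)) \<le> (\<Sum>n. norm (c n) * real (Suc n) powr (- \<sigma>))"
proof -
  have le: "norm (c n * of_nat (Suc n) powr (- s)) \<le> norm (c n) * real (Suc n) powr (- \<sigma>)" for n
    unfolding norm_mult norm_of_nat_Suc_powr using assms(2) by (intro mult_left_mono powr_mono) auto
  show summ: "summable (\<lambda>n. norm (c n * of_nat (Suc n) powr (- s)))"
    by (rule summable_comparison_test'[OF assms(1), of 0]) (use le in auto)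
  show "norm (\<Sum>n. c n * of_nat (Suc n) powr (- s)) \<le> (\<Sum>n. norm (c n) * real (Suc n) powr (- \<sigma>))"
    by (rule order_trans[OF summable_norm[OF summ]], rule suminf_le[OF le summ assms(1)])
qed

lemma dirichlet_series_holomorphic:
  fixes c :: "nat \<Rightarrow> complex"
  assumes summ: "\<And>\<sigma>. \<sigma> > a \<Longrightarrow> summable (\<lambda>n. norm (c n) * real (Suc n) powr (- \<sigma>))"
  shows "(\<lambda>s. \<Sum>n. c n * of_nat (Suc n) powr (- s)) holomorphic_on {s. Re s > a}"
proof (rule holomorphic_uniform_sequence[where f = "\<lambda>N s. \<Sum>n<N. c n * of_nat (Suc n) powr (- s)"])
  show "open {s. Re s > a}" by (rule open_halfspace_Re_gt)
  show "(\<lambda>s. \<Sum>n<N. c n * of_nat (Suc n) powr (- s)) holomorphic_on {s. Re s > a}" for N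
    by (intro holomorphic_intros)
  fix s assume "s \<in> {s. Re s > a}"
  define d where "d = (Re s - a) / 2"
  have d: "d > 0" using \<open>s \<in> _\<close> by (simp add: d_def)
  have Re: "Re z \<ge> a + d" if "z \<in> cball s d" for z
    using that abs_Re_le_cmod[of "s - z"] by (simp add: dist_norm d_def field_simps)
  have "uniform_limit (cball s d) (\<lambda>N s. \<Sum>n<N. c n * of_nat (Suc n) powr (- s))
          (\<lambda>s. \<Sum>n. c n * of_nat (Suc n) powr (- s)) sequentially"
  proof (rule Weierstrass_m_test[OF _ summ[of "a + d"]])
    fix n z assume "z \<in> cball s d"
    then show "norm (c n * of_nat (Suc n) powr (- z)) \<le> norm (c n) * real (Suc n) powr (- (a + d))"
      unfolding norm_mult norm_of_nat_Suc_powr using Re[of z] by (intro mult_left_mono powr_mono) auto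
  qed (use d in auto)
  moreover have "cball s d \<subseteq> {s. Re s > a}" using Re d by force
  ultimately show "\<exists>d>0. cball s d \<subseteq> {s. Re s > a} \<and>
      uniform_limit (cball s d) (\<lambda>N s. \<Sum>n<N. c n * of_nat (Suc n) powr (- s))
          (\<lambda>s. \<Sum>n. c n * of_nat (Suc n) powr (- s)) sequentially"
    using d by blast
qed

text \<open>The integrals are evaluated for real arguments only; an interval has an interior limit
  point, so the identity theorem carries such evaluations over to complex arguments.\<close>

lemma analytic_continuation_real_interval:
  fixes f g :: "complex \<Rightarrow> complex"
  assumes hol: "f holomorphic_on S" "g holomorphic_on S" and S: "open S" "connected S"
    and ab: "a < b" and sub: "\<And>x. a < x \<Longrightarrow> x < b \<Longrightarrow> of_real x \<in> S"
    and eq: "\<And>x. a < x \<Longrightarrow> x < b \<Longrightarrow> f (of_real x) = g (of_real x)"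
    and z: "z \<in> S"
  shows "f z = g z"
proof -
  define m where "m = (a + b) / 2"
  have m: "a < m" "m < b" using ab by (auto simp: m_def)
  have "complex_of_real m islimpt complex_of_real ` {a<..<b}"
    unfolding islimpt_approachable
  proof safe
    fix e :: real assume e: "e > 0"
    define h where "h = min (e / 2) ((b - m) / 2)"
    have h: "0 < h" "h < e" "h < b - m" using e m by (auto simp: h_def min_def)
    have "dist (complex_of_real (m + h)) (of_real m) = h"
      unfolding dist_of_real using h by (simp add: dist_real_def)
    then show "\<exists>x'\<in>complex_of_real ` {a<..<b}. x' \<noteq> of_real m \<and> dist x' (of_real m) < e"
      using h m by (intro bexI[of _ "of_real (m + h)"] imageI) auto
  qed
  then have "f z - g z = 0"
    using m by (intro analytic_continuation[of "\<lambda>z. f z - g z" S "complex_of_real ` {a<..<b}" "of_real m" z]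
      holomorphic_on_diff hol S z sub) (auto simp: sub eq)
  then show ?thesis by simp
qed

definition mellin_bose_reg :: "complex \<Rightarrow> complex" where
  "mellin_bose_reg s = (LINT x:{0<..}|lborel. of_real x powr (s - 1) * complex_of_real (bose_reg x))"

lemma mellin_bose_reg_of_real:
  assumes "has_bochner_integral lborel (\<lambda>x. indicator {0<..} x * (x powr (s - 1) * bose_reg x)) I"
  shows "mellin_bose_reg (of_real s) = of_real I"
proof -
  have "mellin_bose_reg (of_real s) =
          (LINT x|lborel. complex_of_real (indicator {0<..} x * (x powr (s - 1) * bose_reg x)))"
    unfolding mellin_bose_reg_def set_lebesgue_integral_def
  proof (intro Bochner_Integration.integral_cong refl)
    fix x :: real
    have "of_real x powr (of_real s - 1) = complex_of_real (x powr (s - 1))" if "x > 0"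
      using powr_of_real[of x "s - 1"] that by simp
    then show "indicator {0<..} x *\<^sub>R (of_real x powr (of_real s - 1) * complex_of_real (bose_reg x)) =
               complex_of_real (indicator {0<..} x * (x powr (s - 1) * bose_reg x))"
      by (auto simp: indicator_def)
  qed
  moreover have "has_bochner_integral lborel (\<lambda>x. complex_of_real (indicator {0<..} x * (x powr (s - 1) * bose_reg x))) (of_real I)"
    by (rule has_bochner_integral_of_real[OF assms])
  then have "(LINT x|lborel. complex_of_real (indicator {0<..} x * (x powr (s - 1) * bose_reg x))) = of_real I"
    by (rule has_bochner_integral_integral_eq)
  ultimately show ?thesis by simp
qed

text \<open>Continuation to \<open>Re s > -1\<close>: the Mellin transform of \<open>1 / (e\<^sup>x - 1)\<close> is
  \<open>\<Gamma>(s) \<zeta>(s)\<close>, and the two terms removed near \<open>0\<close> contribute \<open>1 / (s - 1)\<close> and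
  \<open>-1 / (2 s)\<close>; the pole of the latter at \<open>0\<close> is absorbed in \<open>1 / \<Gamma>(s) = s / \<Gamma>(s + 1)\<close>.\<close>
definition zeta_right :: "complex \<Rightarrow> complex" where
  "zeta_right s = rGamma s * (1 / (s - 1) + mellin_bose_reg s) - rGamma (s + 1) / 2"

lemma zeta_right_holomorphic: "zeta_right holomorphic_on {s. Re s > -1} - {1}"
proof -
  have "mellin_bose_reg holomorphic_on {s. Re s > -1}"
    unfolding mellin_bose_reg_def by (intro mellin_transform_holomorphic set_integrable_bose_reg) auto
  then have "mellin_bose_reg holomorphic_on {s. Re s > -1} - {1}"
    by (rule holomorphic_on_subset) auto
  then show ?thesis
    unfolding zeta_right_def by (intro holomorphic_intros) auto
qed

text \<open>The value assumed for the integral has the shape found both for s > 1 and for -1 < s <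
  0, with \<open>I\<close> as the part that differs; the elementary terms cancel against those built
  into \<open>zeta_right\<close>.\<close>

lemma zeta_right_of_real:
  assumes I: "has_bochner_integral lborel (\<lambda>x. indicator {0<..} x * (x powr (s - 1) * bose_reg x))
                (I - 1 / (s - 1) + 1 / (2 * s))" and s: "s \<noteq> 0" "s \<noteq> 1"
  shows "zeta_right (of_real s) = rGamma (of_real s) * of_real I"
proof -
  define r where "r = rGamma (complex_of_real s + 1)"
  have r: "rGamma (complex_of_real s) = of_real s * r"
    unfolding r_def by (rule rGamma_plus1[symmetric])
  \<comment> \<open>Here \<open>a\<close> stands for 1 / (s - 1); the contribution of 1 / (2 s)
    becomes r / 2 and is removed by the last term.\<close>
  have "complex_of_real s * r * (a + (J - a + 1 / (2 * of_real s))) - r / 2 = of_real s * r * J" for a J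
    using s by (simp add: field_simps)
  from this[of "1 / (of_real s - 1)" "of_real I"] show ?thesis
    unfolding zeta_right_def mellin_bose_reg_of_real[OF I] r_def[symmetric] r by simp
qed

lemma suminf_Suc_powr_of_real:
  assumes "s < -1"
  shows "(\<Sum>n. of_nat (Suc n) powr (of_real s) :: complex) = of_real (\<Sum>n. real (Suc n) powr s)"
proof -
  have "of_nat (Suc n) powr of_real s = complex_of_real (real (Suc n) powr s)" for n
    using powr_of_real[of "real (Suc n)" s] by simp
  then have "(\<Sum>n. of_nat (Suc n) powr (of_real s) :: complex) = (\<Sum>n. of_real (real (Suc n) powr s))"
    by (simp only:)
  also have "\<dots> = of_real (\<Sum>n. real (Suc n) powr s)"
    by (rule suminf_of_real[OF summable_Suc_powr[OF assms], symmetric])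
  finally show ?thesis .
qed

lemma zeta_right_gt_1_real:
  assumes "s > (1::real)"
  shows "zeta_right (of_real s) = (\<Sum>n. of_nat (Suc n) powr (- of_real s))"
proof -
  have "zeta_right (of_real s) = rGamma (of_real s) * of_real (Gamma s * (\<Sum>n. real (Suc n) powr (- s)))"
    using assms by (intro zeta_right_of_real has_bochner_integral_bose_reg_gt_1) auto
  moreover have "rGamma (complex_of_real s) * of_real (Gamma s) = 1"
  proof -
    have "Gamma s \<noteq> 0" using assms by (metis Gamma_real_pos less_irrefl less_trans zero_less_one)
    then show ?thesis by (simp add: rGamma_inverse_Gamma Gamma_complex_of_real flip: of_real_inverse of_real_mult)
  qed
  ultimately show ?thesis
    using suminf_Suc_powr_of_real[of "- s"] assms by (simp add: mult.assoc[symmetric] del: of_nat_Suc)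
qed

lemma zeta_right_eq_dirichlet_series:
  assumes s: "Re s > 1"
  shows "zeta_right s = (\<Sum>n. of_nat (Suc n) powr (- s))"
proof (rule analytic_continuation_real_interval[where S = "{s. Re s > 1}" and a = 1 and b = 2 and z = s
      and f = zeta_right and g = "\<lambda>s. \<Sum>n. of_nat (Suc n) powr (- s)"])
  show "zeta_right holomorphic_on {s. Re s > 1}"
    by (rule holomorphic_on_subset[OF zeta_right_holomorphic]) auto
  show "(\<lambda>s. \<Sum>n. of_nat (Suc n) powr (- s) :: complex) holomorphic_on {s. Re s > 1}"
    using dirichlet_series_holomorphic[of 1 "\<lambda>_. 1"] summable_Suc_powr[of "- \<sigma>" for \<sigma>] by simp
qed (use s zeta_right_gt_1_real in \<open>auto simp: open_halfspace_Re_gt convex_halfspace_Re_gt convex_connected\<close>)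

lemma dirichlet_series_zeta_sums:
  assumes s: "Re s > 1"
  shows "(\<lambda>n. of_nat (Suc n) powr (- s)) sums zeta_right s"
proof -
  have "summable (\<lambda>n. norm (1 * of_nat (Suc n) powr (- s) :: complex))"
    using dirichlet_series_summable(1)[of "\<lambda>_. 1" "Re s" s] summable_Suc_powr[of "- Re s"] s by simp
  then show ?thesis
    using s by (simp add: zeta_right_eq_dirichlet_series summable_sums summable_norm_cancel)
qed

text \<open>The right side of the functional equation, used to define the continuation for Re s < 0.
  There Re (1 - s) > 1, so \<open>zeta_right (1 - s)\<close> is the Dirichlet series and Gamma has
  no pole.\<close>

definition zeta_left :: "complex \<Rightarrow> complex" where
  "zeta_left s = 2 * (2 * of_real pi) powr (s - 1) * sin (of_real pi * s / 2) * Gamma (1 - s) * zeta_right (1 - s)"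

lemma zeta_left_holomorphic: "zeta_left holomorphic_on {s. Re s < 0}"
proof -
  have "zeta_right \<circ> (\<lambda>s. 1 - s) holomorphic_on {s. Re s < 0}"
    by (rule holomorphic_on_compose_gen[OF _ zeta_right_holomorphic]) (auto intro!: holomorphic_intros)
  then have "(\<lambda>s. zeta_right (1 - s)) holomorphic_on {s. Re s < 0}" by (simp add: o_def)
  moreover have "1 - s \<notin> \<int>\<^sub>\<le>\<^sub>0" if "Re s < 0" for s
    using that by (auto elim!: nonpos_Ints_cases simp: complex_eq_iff)
  ultimately show ?thesis
    unfolding zeta_left_def by (intro holomorphic_intros) auto
qed

text \<open>On the real interval, 1 / Gamma(s) = Gamma(1 - s) sin(pi s) / pi, and sin(pi s) = 2
  sin(pi s / 2) cos(pi s / 2) cancels the cosine left by the integral. Connectedness of the strip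
  does the rest.\<close>

lemma zeta_right_eq_zeta_left:
  assumes s: "-1 < Re s" "Re s < 0"
  shows "zeta_right s = zeta_left s"
proof (rule analytic_continuation_real_interval[where S = "{s. Re s > -1} \<inter> {s. Re s < 0}" and a = "-1" and b = 0
      and z = s and f = zeta_right and g = zeta_left])
  show "zeta_right holomorphic_on {s. Re s > -1} \<inter> {s. Re s < 0}"
    by (rule holomorphic_on_subset[OF zeta_right_holomorphic]) auto
  show "zeta_left holomorphic_on {s. Re s > -1} \<inter> {s. Re s < 0}"
    by (rule holomorphic_on_subset[OF zeta_left_holomorphic]) auto
  show "connected ({s. Re s > -1} \<inter> {s. Re s < 0})"
    by (intro convex_connected convex_Int convex_halfspace_Re_gt convex_halfspace_Re_lt)
  show "open ({s. Re s > -1} \<inter> {s. Re s < 0})"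
    by (intro open_Int open_halfspace_Re_gt open_halfspace_Re_lt)
next
  fix x :: real assume x: "-1 < x" "x < 0"
  let ?S = "\<Sum>n. real (Suc n) powr (x - 1)" and ?x = "complex_of_real x"
  have "zeta_right ?x = rGamma ?x * of_real ((2 * pi) powr (x - 1) * pi / cos (pi * x / 2) * ?S)"
    using x by (intro zeta_right_of_real has_bochner_integral_bose_reg_neg) auto
  moreover have "zeta_right (1 - ?x) = of_real ?S"
    using zeta_right_gt_1_real[of "1 - x"] suminf_Suc_powr_of_real[of "x - 1"] x by simp
  moreover have "rGamma ?x = Gamma (1 - ?x) * of_real (sin (pi * x) / pi)"
  proof -
    have "1 - ?x \<notin> \<int>\<^sub>\<le>\<^sub>0"
      using x by (auto elim!: nonpos_Ints_cases simp: complex_eq_iff)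
    then have "Gamma (1 - ?x) * rGamma (1 - ?x) = 1"
      by (simp add: Gamma_def rGamma_eq_zero_iff)
    then have "rGamma ?x = (Gamma (1 - ?x) * rGamma (1 - ?x)) * rGamma ?x"
      by (simp only: mult_1_left)
    also have "\<dots> = Gamma (1 - ?x) * (rGamma ?x * rGamma (1 - ?x))"
      by (simp only: mult_ac)
    also have "rGamma ?x * rGamma (1 - ?x) = of_real (sin (pi * x) / pi)"
      using rGamma_reflection_complex[of ?x] by (simp flip: sin_of_real)
    finally show ?thesis .
  qed
  moreover have "of_real (sin (pi * x) / pi) * of_real ((2 * pi) powr (x - 1) * pi / cos (pi * x / 2) * ?S) =
                 complex_of_real (2 * (2 * pi) powr (x - 1) * sin (pi * x / 2) * ?S)"
    unfolding of_real_mult[symmetric] of_real_eq_iff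
  proof -
    have "sin (pi * x) / pi * ((2 * pi) powr (x - 1) * pi / cos (pi * x / 2)) =
                 2 * (2 * pi) powr (x - 1) * sin (pi * x / 2)"
    proof -
      have "cos (pi * x / 2) > 0"
      proof (rule cos_gt_zero_pi)
        show "- (pi / 2) < pi * x / 2" "pi * x / 2 < pi / 2"
          using x mult_strict_left_mono[of "-1" x pi] mult_strict_left_mono[of x 0 pi] by auto
      qed
      moreover have "sin (pi * x) = 2 * sin (pi * x / 2) * cos (pi * x / 2)"
        using sin_double[of "pi * x / 2"] by simp
      ultimately show ?thesis by simp
    qed
    then show "sin (pi * x) / pi * ((2 * pi) powr (x - 1) * pi / cos (pi * x / 2) * ?S) =
               2 * (2 * pi) powr (x - 1) * sin (pi * x / 2) * ?S"
      by (simp only: mult.assoc[symmetric])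
  qed
  moreover have "(2 * complex_of_real pi) powr (?x - 1) = of_real ((2 * pi) powr (x - 1))"
    using powr_of_real[of "2 * pi" "x - 1"] by simp
  moreover have "sin (of_real pi * ?x / 2) = of_real (sin (pi * x / 2))"
    by (simp flip: sin_of_real)
  ultimately have "zeta_right ?x = Gamma (1 - ?x) * of_real (2 * (2 * pi) powr (x - 1) * sin (pi * x / 2) * ?S)"
    by (simp only: mult.assoc)
  also have "\<dots> = zeta_left ?x"
    unfolding zeta_left_def \<open>zeta_right (1 - ?x) = _\<close> \<open>(2 * complex_of_real pi) powr (?x - 1) = _\<close>
      \<open>sin (of_real pi * ?x / 2) = _\<close> by simp
  finally show "zeta_right ?x = zeta_left ?x" .
qed (use s in auto)

text \<open>Besides the two properties that define \<open>zeta\<close>, the functional equation is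
  recorded for the constructed function, to be transferred afterwards.\<close>

lemma zeta_exists:
  "\<exists>f. f holomorphic_on (- {1}) \<and> (\<forall>s. Re s > 1 \<longrightarrow> (\<lambda>n. of_nat (Suc n) powr (- s)) sums f s) \<and>
       (\<forall>s. Re s < 0 \<longrightarrow> f s = 2 * (2 * of_real pi) powr (s - 1) * sin (of_real pi * s / 2) *
            Gamma (1 - s) * f (1 - s))"
proof -
  \<comment> \<open>The two pieces agree on -1 < Re s < 0, so the gluing is holomorphic on the union
    of their domains, which is the punctured plane.\<close>
  define f where "f = (\<lambda>s. if s \<in> {s. Re s > -1} - {1} then zeta_right s else zeta_left s)"
  have "f holomorphic_on (({s. Re s > -1} - {1}) \<union> {s. Re s < 0})"
    unfolding f_def
    by (rule holomorphic_on_If_Un[OF zeta_right_holomorphic zeta_left_holomorphic])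
       (auto intro: open_halfspace_Re_gt open_halfspace_Re_lt zeta_right_eq_zeta_left)
  also have "({s. Re s > -1} - {1}) \<union> {s. Re s < 0} = - {1::complex}"
    by (auto simp: complex_eq_iff)
  finally have hol: "f holomorphic_on - {1}" .
  have right: "f s = zeta_right s" if "Re s > 1" for s
    using that by (auto simp: f_def)
  have "f s = zeta_left s" if "Re s < 0" for s
    using that zeta_right_eq_zeta_left[of s] by (auto simp: f_def)
  then have left: "f s = 2 * (2 * of_real pi) powr (s - 1) * sin (of_real pi * s / 2) *
            Gamma (1 - s) * f (1 - s)" if "Re s < 0" for s
    using that right[of "1 - s"] by (simp add: zeta_left_def)
  show ?thesis
  proof (intro exI[of _ f] conjI allI impI)
    show "(\<lambda>n. of_nat (Suc n) powr (- s)) sums f s" if "Re s > 1" for s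
      unfolding right[OF that] by (rule dirichlet_series_zeta_sums[OF that])
  qed (fact hol left)+
qed

text \<open>Existence of a continuation turns the choice operator into a function that really has
  the properties it was chosen for.\<close>

lemma zeta_holomorphic: "zeta holomorphic_on (- {1})"
  and zeta_sums: "Re s > 1 \<Longrightarrow> (\<lambda>n. of_nat (Suc n) powr (- s)) sums zeta s"
proof -
  define P where "P = (\<lambda>f::complex \<Rightarrow> complex. f holomorphic_on (- {1}) \<and>
     (\<forall>s. Re s > 1 \<longrightarrow> (\<lambda>n. of_nat (Suc n) powr (- s)) sums f s))"
  have "\<exists>f. P f" using zeta_exists unfolding P_def by blast
  then have "P zeta"
    unfolding zeta_def P_def[symmetric] by (rule someI_ex)
  then have "zeta holomorphic_on (- {1}) \<and> (\<forall>s. Re s > 1 \<longrightarrow> (\<lambda>n. of_nat (Suc n) powr (- s)) sums zeta s)"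
    unfolding P_def .
  then show "zeta holomorphic_on (- {1})"
    and "Re s > 1 \<Longrightarrow> (\<lambda>n. of_nat (Suc n) powr (- s)) sums zeta s" by auto
qed

lemma zeta_functional_equation:
  assumes s: "Re s < 0"
  shows "zeta s = 2 * (2 * of_real pi) powr (s - 1) * sin (of_real pi * s / 2) * Gamma (1 - s) * zeta (1 - s)"
proof -
  obtain f where f: "f holomorphic_on (- {1})" "\<forall>s. Re s > 1 \<longrightarrow> (\<lambda>n. of_nat (Suc n) powr (- s)) sums f s"
    "\<forall>s. Re s < 0 \<longrightarrow> f s = 2 * (2 * of_real pi) powr (s - 1) * sin (of_real pi * s / 2) * Gamma (1 - s) * f (1 - s)"
    using zeta_exists by (elim exE conjE) (rule that)
  \<comment> \<open>Whichever continuation was chosen, it agrees with the constructed one on Re z >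
    1 and hence on the connected punctured plane.\<close>
  have "zeta z = f z" if "z \<noteq> 1" for z
  proof (rule analytic_continuation_open[where s = "{s. Re s > 1}" and s' = "- {1}" and f = zeta and g = f])
    show "zeta z = f z" if "z \<in> {s. Re s > 1}" for z
      using that f(2) zeta_sums by (auto intro: sums_unique2)
    show "connected (- {1::complex})" by (rule connected_punctured_universe) simp
    have "complex_of_real 2 \<in> {s. Re s > 1}" by simp
    then show "{s. Re s > 1} \<noteq> {}" by blast
  qed (use that f(1) zeta_holomorphic in \<open>auto simp: open_halfspace_Re_gt\<close>)
  then have "zeta s = f s" "zeta (1 - s) = f (1 - s)" using s by (auto simp: complex_eq_iff)
  with f(3) s show ?thesis by metis
qed

section \<open>Lower bounds for Gamma and zeta\<close>

text \<open>After squaring, the common term in a^2 b^2 cancels and b^2 y^2 <= a^2 y^2 remains. This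
  is the monotonicity of x / |x + i y| in x, with denominators cleared.\<close>

lemma cmod_ratio_mono:
  fixes a b y :: real
  assumes "0 \<le> b" "b \<le> a"
  shows "b * cmod (Complex a y) \<le> a * cmod (Complex b y)"
proof (rule power2_le_imp_le)
  have "b\<^sup>2 * y\<^sup>2 \<le> a\<^sup>2 * y\<^sup>2"
    using assms by (intro mult_right_mono power_mono) auto
  then show "(b * cmod (Complex a y))\<^sup>2 \<le> (a * cmod (Complex b y))\<^sup>2"
    by (simp add: power_mult_distrib cmod_power2 algebra_simps)
qed (use assms in auto)

lemma norm_Gamma_series:
  fixes x y :: real
  shows "norm (Gamma_series (Complex x y) n) =
           fact n * exp (x * ln (real n)) / (\<Prod>k=0..n. cmod (Complex (x + real k) y))"
proof -
  have "Complex x y + of_nat k = Complex (x + real k) y" for k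
    by (simp add: complex_eq_iff)
  then show ?thesis
    by (simp add: Gamma_series_def norm_mult norm_divide pochhammer_prod atLeastLessThanSuc_atLeastAtMost
          flip: prod_norm)
qed

text \<open>By Euler's product, \<open>\<bar>\<Gamma>(x + i y)\<bar> / \<Gamma>(x)\<close> is the product of the factors
  \<open>(x + k) / \<bar>x + k + i y\<bar>\<close>, each of which increases with \<open>x\<close>.\<close>
lemma norm_Gamma_ge:
  fixes x y :: real
  assumes x: "x \<ge> 1"
  shows "norm (Gamma (Complex x y)) \<ge> Gamma x * norm (Gamma (Complex 1 y))"
proof -
  have "norm (Gamma (Complex x 0)) * norm (Gamma (Complex 1 y)) \<le>
        norm (Gamma (Complex x y)) * norm (Gamma (Complex 1 0))"
  proof (rule LIMSEQ_le)
    show "(\<lambda>n. norm (Gamma_series (Complex x 0) n) * norm (Gamma_series (Complex 1 y) n))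
            \<longlonglongrightarrow> norm (Gamma (Complex x 0)) * norm (Gamma (Complex 1 y))"
      by (intro tendsto_intros)
    show "(\<lambda>n. norm (Gamma_series (Complex x y) n) * norm (Gamma_series (Complex 1 0) n))
            \<longlonglongrightarrow> norm (Gamma (Complex x y)) * norm (Gamma (Complex 1 0))"
      by (intro tendsto_intros)
    have "norm (Gamma_series (Complex x 0) n) * norm (Gamma_series (Complex 1 y) n) \<le>
          norm (Gamma_series (Complex x y) n) * norm (Gamma_series (Complex 1 0) n)" for n
    proof -
      \<comment> \<open>The denominator of the n-th approximation at a + i b. The numerators on the
        two sides have the same product, so only the \<open>Q\<close> are compared, factor by
        factor.\<close>
      define Q where "Q = (\<lambda>a b. \<Prod>k=0..n. cmod (Complex (a + real k) b))"
      have Q_pos: "Q a b > 0" if "a \<ge> 1" for a b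
        unfolding Q_def using that by (intro prod_pos) (auto simp: complex_eq_iff)
      have "Q x y * Q 1 0 \<le> Q x 0 * Q 1 y"
        unfolding Q_def prod.distrib[symmetric]
      proof (rule prod_mono)
        fix k
        show "0 \<le> cmod (Complex (x + real k) y) * cmod (Complex (1 + real k) 0) \<and>
              cmod (Complex (x + real k) y) * cmod (Complex (1 + real k) 0) \<le>
              cmod (Complex (x + real k) 0) * cmod (Complex (1 + real k) y)"
          using cmod_ratio_mono[of "1 + real k" "x + real k" y] x
          by (simp add: complex_norm mult.commute)
      qed
      then have "1 / (Q x 0 * Q 1 y) \<le> 1 / (Q x y * Q 1 0)"
        using Q_pos x by (intro divide_left_mono mult_pos_pos) auto
      then have "(fact n * exp (x * ln (real n))) * (fact n * exp (1 * ln (real n))) * (1 / (Q x 0 * Q 1 y)) \<le>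
                 (fact n * exp (x * ln (real n))) * (fact n * exp (1 * ln (real n))) * (1 / (Q x y * Q 1 0))"
        by (intro mult_left_mono) auto
      then show ?thesis
        unfolding norm_Gamma_series Q_def by simp
    qed
    then show "\<exists>N. \<forall>n\<ge>N. norm (Gamma_series (Complex x 0) n) * norm (Gamma_series (Complex 1 y) n) \<le>
          norm (Gamma_series (Complex x y) n) * norm (Gamma_series (Complex 1 0) n)" by blast
  qed
  moreover have "Gamma (Complex x 0) = of_real (Gamma x)"
    by (simp add: complex_of_real_def[symmetric] Gamma_complex_of_real)
  moreover have "Gamma (Complex 1 0) = 1"
    by (simp add: complex_of_real_def[symmetric])
  moreover have "Gamma x > 0"
    using x by (intro Gamma_real_pos) auto
  ultimately show ?thesis by simp
qed

text \<open>As Gamma commutes with conjugation, the square of the norm is Gamma(1 + i y) Gamma(1 - i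
  y), which reflection evaluates as pi y / sinh(pi y); then sinh <= exp.\<close>

lemma norm_Gamma_one_plus_imaginary:
  fixes y :: real
  assumes y: "y \<noteq> 0"
  shows "norm (Gamma (Complex 1 y)) \<ge> sqrt (pi * \<bar>y\<bar>) * exp (- pi * \<bar>y\<bar> / 2)"
proof (rule power2_le_imp_le)
  let ?z = "\<i> * complex_of_real y"
  have C: "Complex 1 y = ?z + 1" "cnj (Complex 1 y) = 1 - ?z" by (simp_all add: complex_eq_iff)
  have z: "?z \<notin> \<int>\<^sub>\<le>\<^sub>0" using y by (auto elim!: nonpos_Ints_cases simp: complex_eq_iff)
  have S: "sin (of_real pi * ?z) = \<i> * of_real (sinh (pi * y))"
    by (simp add: complex_eq_iff Re_sin Im_sin sinh_def)
  have "norm (Gamma (Complex 1 y)) ^ 2 = norm (Gamma (Complex 1 y) * Gamma (cnj (Complex 1 y)))"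
    by (simp add: norm_mult power2_eq_square flip: cnj_Gamma)
  also have "Gamma (Complex 1 y) * Gamma (cnj (Complex 1 y)) = ?z * (Gamma ?z * Gamma (1 - ?z))"
    unfolding C by (simp add: Gamma_plus1[OF z] mult.assoc)
  also have "\<dots> = of_real (pi * y / sinh (pi * y))"
    unfolding Gamma_reflection_complex S by simp
  finally have N: "norm (Gamma (Complex 1 y)) ^ 2 = pi * \<bar>y\<bar> / \<bar>sinh (pi * y)\<bar>"
    by (simp only: norm_of_real) (simp add: abs_mult)
  have "\<bar>sinh (pi * y)\<bar> = sinh (pi * \<bar>y\<bar>)"
    using sinh_real_abs[of "pi * y"] unfolding abs_mult by simp
  also have "\<dots> \<le> exp (pi * \<bar>y\<bar>)"
    using sinh_minus_cosh[of "pi * \<bar>y\<bar>"] cosh_plus_sinh[of "pi * \<bar>y\<bar>"] cosh_real_ge_1[of "pi * \<bar>y\<bar>"] by linarith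
  finally have "pi * \<bar>y\<bar> / exp (pi * \<bar>y\<bar>) \<le> pi * \<bar>y\<bar> / \<bar>sinh (pi * y)\<bar>"
    using y by (intro divide_left_mono) auto
  moreover have "(sqrt (pi * \<bar>y\<bar>) * exp (- pi * \<bar>y\<bar> / 2))\<^sup>2 = pi * \<bar>y\<bar> / exp (pi * \<bar>y\<bar>)"
  proof -
    have "(exp (- pi * \<bar>y\<bar> / 2))\<^sup>2 = exp (- (pi * \<bar>y\<bar>))"
      unfolding exp_double[symmetric] by (intro arg_cong[of _ _ exp]) simp
    moreover have "(sqrt (pi * \<bar>y\<bar>))\<^sup>2 = pi * \<bar>y\<bar>" by simp
    ultimately show ?thesis
      unfolding power_mult_distrib by (simp only: exp_minus divide_inverse)
  qed
  ultimately show "(sqrt (pi * \<bar>y\<bar>) * exp (- pi * \<bar>y\<bar> / 2))\<^sup>2 \<le> norm (Gamma (Complex 1 y)) ^ 2"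
    unfolding N by simp
qed auto

text \<open>The two exponentials in sin z have moduli exp(Im z) and exp(-Im z); the reverse triangle
  inequality applies, and the smaller of them is at most 1.\<close>

lemma norm_sin_ge:
  fixes z :: complex
  shows "norm (sin z) \<ge> (exp \<bar>Im z\<bar> - 1) / 2"
proof -
  have "exp \<bar>Im z\<bar> - 1 \<le> exp \<bar>Im z\<bar> - exp (- \<bar>Im z\<bar>)" by simp
  also have "\<dots> \<le> \<bar>exp (Im z) - exp (- Im z)\<bar>" by (auto simp: abs_if)
  also have "\<dots> = \<bar>norm (exp (- (\<i> * z))) - norm (exp (\<i> * z))\<bar>" by simp
  also have "\<dots> \<le> norm (exp (\<i> * z) - exp (- (\<i> * z)))"
    by (metis abs_minus_commute norm_triangle_ineq3)
  also have "\<dots> = 2 * norm (sin z)"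
    by (simp add: sin_exp_eq norm_mult norm_divide)
  finally show ?thesis by simp
qed

section \<open>A sieve by finitely many primes, and zeta away from 0 to the right of 1\<close>

lemma norm_of_nat_powr: "norm (of_nat n powr s :: complex) = real n powr Re s"
  by (cases n) (simp_all add: norm_of_nat_Suc_powr del: of_nat_Suc)

text \<open>The sieve sums over sets cut out by divisibility conditions, hence unordered sums and an
  arbitrary index set \<open>A\<close>. The term n = 0 vanishes because
  \<open>0 powr z = 0\<close>.\<close>

lemma abs_summable_on_nat_powr:
  assumes "Re w > 1"
  shows "(\<lambda>n. norm (of_nat n powr (- w) :: complex)) summable_on A"
proof -
  have "summable (\<lambda>n. real n powr (- Re w))"
    using assms by (simp add: summable_real_powr_iff)
  then have "(\<lambda>n. real n powr (- Re w)) summable_on UNIV"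
    by (subst summable_on_UNIV_nonneg_real_iff) auto
  then show ?thesis
    unfolding norm_of_nat_powr by (auto intro: summable_on_subset_banach)
qed

lemma zeta_has_sum:
  assumes "Re w > 1"
  shows "((\<lambda>n. of_nat n powr (- w)) has_sum zeta w) {1..}"
proof -
  have "summable (\<lambda>n. norm (of_nat (Suc n) powr (- w) :: complex))"
    using summable_Suc_powr[of "- Re w"] assms unfolding norm_of_nat_powr by simp
  then have "((\<lambda>n. of_nat (Suc n) powr (- w)) has_sum zeta w) UNIV"
    using zeta_sums[OF assms] by (rule norm_summable_imp_has_sum)
  moreover have "bij_betw Suc UNIV {1..}"
    by (rule bij_betw_byWitness[of _ "\<lambda>n. n - 1"]) auto
  ultimately show ?thesis
    using has_sum_reindex_bij_betw[of Suc UNIV "{1..}" "\<lambda>n. of_nat n powr (- w)"] by simp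
qed

text \<open>Multiplying the sum by p^(-w) reproduces its terms at the multiples of p, so the factor
  1 - p^(-w) deletes exactly these.\<close>

lemma zeta_sieve:
  fixes w :: complex
  assumes w: "Re w > 1" and P: "finite P" "\<And>p. p \<in> P \<Longrightarrow> prime p"
  shows "((\<lambda>n. of_nat n powr (- w)) has_sum (zeta w * (\<Prod>p\<in>P. 1 - of_nat p powr (- w))))
           {n::nat. n \<ge> 1 \<and> (\<forall>p\<in>P. \<not> p dvd n)}"
  using P
proof (induction P rule: finite_induct)
  case empty
  then show ?case using zeta_has_sum[OF w] by (simp add: atLeast_def)
next
  case (insert p P)
  let ?f = "\<lambda>n. of_nat n powr (- w) :: complex"
  let ?A = "\<lambda>P. {n::nat. n \<ge> 1 \<and> (\<forall>p\<in>P. \<not> p dvd n)}"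
  let ?S = "zeta w * (\<Prod>p\<in>P. 1 - of_nat p powr (- w))"
  have p: "prime p" "p > 0" using insert.prems prime_gt_0_nat by auto
  have S: "(?f has_sum ?S) (?A P)" using insert by blast
  have "((\<lambda>n. ?f (p * n)) has_sum (?f p * ?S)) (?A P)"
  proof -
    have "?f (p * n) = ?f p * ?f n" for n
      using powr_times_real[of "of_nat p" "of_nat n" "- w"] by simp
    then show ?thesis using has_sum_cmult_right[OF S, of "?f p"] by simp
  qed
  moreover have inj: "inj_on (\<lambda>n. p * n) (?A P)" using p by (auto simp: inj_on_def)
  ultimately have "(?f has_sum (?f p * ?S)) ((\<lambda>n. p * n) ` ?A P)"
    by (subst has_sum_reindex) (auto simp: o_def)
  \<comment> \<open>Absolute convergence provides some value \<open>T\<close> for the sieved sum;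
    uniqueness of the sum over the disjoint union then determines it.\<close>
  moreover obtain T where T: "(?f has_sum T) (?A (insert p P))"
    using abs_summable_summable[OF abs_summable_on_nat_powr[OF w]] by (auto simp: summable_on_def)
  ultimately have "(?f has_sum (?f p * ?S + T)) ((\<lambda>n. p * n) ` ?A P \<union> ?A (insert p P))"
    by (intro has_sum_Un_disjoint) auto
  also have "(\<lambda>n. p * n) ` ?A P \<union> ?A (insert p P) = ?A P"
  proof (intro equalityI subsetI)
    fix n assume n: "n \<in> ?A P"
    show "n \<in> (\<lambda>n. p * n) ` ?A P \<union> ?A (insert p P)"
    proof (cases "p dvd n")
      case True
      then obtain m where m: "n = p * m" by blast
      with n have "m \<in> ?A P" by (auto intro: Suc_leI)
      with m show ?thesis by blast
    qed (use n in auto)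
  next
    fix n assume "n \<in> (\<lambda>n. p * n) ` ?A P \<union> ?A (insert p P)"
    \<comment> \<open>Multiplication by the new prime introduces no divisor from \<open>P\<close>:
      such a divisor would have to be p itself.\<close>
    moreover have "\<not> q dvd p * m" if "m \<in> ?A P" "q \<in> P" for m q
    proof
      assume "q dvd p * m"
      moreover have "prime q" using insert.prems that by auto
      ultimately have "q dvd p" using that by (auto simp: prime_dvd_mult_iff)
      then have "q = p" using \<open>prime q\<close> p by (simp add: primes_dvd_imp_eq)
      with insert.hyps that show False by simp
    qed
    ultimately show "n \<in> ?A P" using p by (auto intro: Suc_leI)
  qed
  finally have "?f p * ?S + T = ?S" using S by (rule has_sum_unique)
  then have "T = zeta w * (\<Prod>p\<in>insert p P. 1 - of_nat p powr (- w))"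
    using insert.hyps by (simp add: algebra_simps)
  with T show ?case by simp
qed

text \<open>Sieving by all primes up to a large bound leaves 1 plus a tail of size at most 1 / 2.
  The primes depend only on \<sigma>, and each sieve factor has modulus at most 2, so dividing by
  them costs only a fixed power of 2.\<close>

lemma zeta_bounded_away_from_0:
  assumes "\<sigma> > 1"
  obtains c where "c > 0" "\<And>w. Re w \<ge> \<sigma> \<Longrightarrow> norm (zeta w) \<ge> c"
proof -
  let ?g = "\<lambda>n. real n powr (- \<sigma>)"
  have g: "?g summable_on A" for A
    using abs_summable_on_nat_powr[of "of_real \<sigma>" A] assms unfolding norm_of_nat_powr by simp
  obtain F where F: "finite F" "dist (sum ?g F) (infsum ?g UNIV) \<le> 1 / 2"
    using has_sum_finite_approximation[OF has_sum_infsum[OF g], of "1 / 2" UNIV] by auto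
  define P where "P = {p. prime p \<and> p \<le> Max F}"
  have P: "finite P" "\<And>p. p \<in> P \<Longrightarrow> prime p"
    unfolding P_def by auto
  have tail: "infsum ?g (UNIV - F) \<le> 1 / 2"
  proof -
    have "infsum ?g (UNIV - F) = infsum ?g UNIV - sum ?g F"
      using infsum_Diff[OF g g, of F UNIV] F(1) by simp
    then show ?thesis using F(2) abs_le_D2 unfolding dist_real_def by fastforce
  qed
  have "norm (zeta w) \<ge> 1 / 2 / 2 ^ card P" if w: "Re w \<ge> \<sigma>" for w
  proof -
    let ?f = "\<lambda>n. of_nat n powr (- w) :: complex"
    let ?A = "{n::nat. n \<ge> 1 \<and> (\<forall>p\<in>P. \<not> p dvd n)}"
    let ?E = "\<Prod>p\<in>P. 1 - of_nat p powr (- w) :: complex"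
    have w1: "Re w > 1" using w assms by simp
    have abs: "(\<lambda>n. norm (?f n)) summable_on B" for B by (rule abs_summable_on_nat_powr[OF w1])
    have one: "1 \<in> ?A" using P(2) not_prime_unit by auto
    \<comment> \<open>A surviving n other than 1 has a prime factor outside \<open>P\<close>, hence
      larger than \<open>Max F\<close>, and n is at least as large.\<close>
    have "?A - {1} \<subseteq> UNIV - F"
    proof
      fix n assume "n \<in> ?A - {1}"
      then have n: "n \<ge> 1" "\<forall>p\<in>P. \<not> p dvd n" "n \<noteq> 1" by auto
      then obtain p where p: "prime p" "p dvd n" using prime_factor_nat by blast
      then have "p \<le> n" using n by (intro dvd_imp_le) auto
      moreover have "\<not> p \<le> Max F" using n p by (auto simp: P_def)
      ultimately show "n \<in> UNIV - F" using F(1) by (meson DiffI Max_ge UNIV_I order_trans)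
    qed
    have "norm (infsum ?f (?A - {1})) \<le> infsum (\<lambda>n. norm (?f n)) (?A - {1})"
      by (rule norm_infsum_bound[OF abs])
    also have "\<dots> \<le> infsum ?g (UNIV - F)"
    proof (rule infsum_mono_neutral)
      fix n :: nat assume "n \<in> (?A - {1}) \<inter> (UNIV - F)"
      then show "norm (?f n) \<le> ?g n" unfolding norm_of_nat_powr using w by (intro powr_mono) auto
    qed (use abs g \<open>?A - {1} \<subseteq> UNIV - F\<close> in auto)
    also note tail
    finally have small: "norm (infsum ?f (?A - {1})) \<le> 1 / 2" .
    have "infsum ?f ?A = ?f 1 + infsum ?f (?A - {1})"
      using infsum_insert[OF abs_summable_summable[OF abs], of 1 "?A - {1}"] one by (simp add: insert_absorb)
    moreover have "infsum ?f ?A = zeta w * ?E"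
      using zeta_sieve[OF w1 P] by (rule infsumI)
    ultimately have "zeta w * ?E = 1 + infsum ?f (?A - {1})" by simp
    then have "1 / 2 \<le> norm (zeta w * ?E)"
      using small norm_diff_ineq[of 1 "infsum ?f (?A - {1})"] by simp
    also have "\<dots> \<le> norm (zeta w) * 2 ^ card P"
    proof -
      have "norm (1 - of_nat p powr (- w) :: complex) \<le> 2" if "p \<in> P" for p
      proof -
        have "norm (1 - of_nat p powr (- w) :: complex) \<le> 1 + real p powr (- Re w)"
          using norm_triangle_ineq4[of 1 "of_nat p powr (- w) :: complex"] unfolding norm_of_nat_powr by simp
        also have "real p powr (- Re w) \<le> real p powr 0"
          using P(2)[OF that] prime_ge_1_nat w1 by (intro powr_mono) auto
        finally show ?thesis using P(2)[OF that] prime_gt_0_nat by auto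
      qed
      then have "norm ?E \<le> (\<Prod>p\<in>P. 2)"
        unfolding prod_norm[symmetric] by (intro prod_mono) auto
      then show ?thesis unfolding norm_mult by (intro mult_left_mono) auto
    qed
    finally show ?thesis by (simp add: field_simps)
  qed
  then show ?thesis by (intro that[of "1 / 2 / 2 ^ card P"]) auto
qed

section \<open>Zeros in the strip\<close>

text \<open>Subtracting 1 makes the series start at the integer 2. Of each term m^(-2 (n + 1)) a
  factor m^(-2) is kept for summability, and the rest is at most 4^(-n). This geometric decay makes
  E entire.\<close>

lemma zeta_even_minus_1_bound:
  obtains K where "\<And>n. norm (zeta (of_nat (2 * Suc n)) - 1) \<le> K * (1 / 4) ^ n"
proof -
  let ?h = "\<lambda>m. real (Suc (Suc m)) powr (- 2)"
  have h: "summable ?h"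
    using summable_Suc_powr[of "- 2"] by (subst summable_Suc_iff[of "\<lambda>m. real (Suc m) powr - 2"]) auto
  have "norm (zeta (of_nat (2 * Suc n)) - 1) \<le> suminf ?h * (1 / 4) ^ n" for n
  proof -
    define s :: complex where "s = of_nat (2 * Suc n)"
    have Re_s: "Re s = 2 + 2 * real n" by (simp add: s_def)
    have "(\<lambda>m. of_nat (Suc m) powr (- s)) sums zeta s"
      by (rule zeta_sums) (simp add: Re_s)
    then have sums: "(\<lambda>m. of_nat (Suc (Suc m)) powr (- s)) sums (zeta s - 1)"
      using sums_Suc_iff[of "\<lambda>m. of_nat (Suc m) powr (- s)" "zeta s - 1"] by simp
    have le: "norm (of_nat (Suc (Suc m)) powr (- s) :: complex) \<le> ?h m * (1 / 4) ^ n" for m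
    proof -
      let ?x = "real (Suc (Suc m))"
      have "norm (of_nat (Suc (Suc m)) powr (- s) :: complex) = ?x powr (- 2) * ?x powr (- 2 * real n)"
        unfolding norm_of_nat_powr powr_add[symmetric] by (simp add: Re_s)
      also have "?x powr (- 2 * real n) = (?x powr (- 2)) ^ n"
        by (subst powr_power) (auto simp: mult.commute)
      also have "(?x powr (- 2)) ^ n \<le> (1 / 4) ^ n"
      proof (rule power_mono)
        have "?x powr (- 2) \<le> 2 powr (- 2)"
          by (intro powr_mono2') auto
        then show "?x powr (- 2) \<le> 1 / 4" by (simp add: powr_minus)
      qed auto
      finally show ?thesis by (simp add: mult_left_mono)
    qed
    have summ: "summable (\<lambda>m. norm (of_nat (Suc (Suc m)) powr (- s) :: complex))"
      by (rule summable_comparison_test'[OF summable_mult2[OF h, of "(1 / 4) ^ n"], of 0]) (use le in auto)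
    have "norm (zeta s - 1) \<le> (\<Sum>m. norm (of_nat (Suc (Suc m)) powr (- s) :: complex))"
      using summable_norm[OF summ] sums by (simp add: sums_iff)
    also have "\<dots> \<le> (\<Sum>m. ?h m * (1 / 4) ^ n)"
      by (rule suminf_le[OF le summ summable_mult2[OF h]])
    also have "\<dots> = suminf ?h * (1 / 4) ^ n"
      by (rule suminf_mult2[OF h, symmetric])
    finally show ?thesis by (simp add: s_def)
  qed
  then show ?thesis by (rule that)
qed

lemma summable_E_fun_coeffs:
  "summable (\<lambda>n. norm (zeta (of_nat (2 * Suc n)) - 1) * real (Suc n) powr (- \<sigma>))"
proof -
  obtain K where K: "\<And>n. norm (zeta (of_nat (2 * Suc n)) - 1) \<le> K * (1 / 4) ^ n"
    using zeta_even_minus_1_bound by blast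
  \<comment> \<open>Weakening the ratio from 1 / 4 to 1 / 2 absorbs the power of n, whatever
    \<sigma> is.\<close>
  have "summable (\<lambda>n. (1 / 4) ^ n * (1 + real n) powr (- \<sigma>))"
  proof (rule summable_comparison_test_bigo)
    show "summable (\<lambda>n. norm ((1 / 2 :: real) ^ n))" by simp
    show "(\<lambda>n. (1 / 4) ^ n * (1 + real n) powr (- \<sigma>)) \<in> O(\<lambda>n. (1 / 2) ^ n)"
      by real_asymp
  qed
  then have "summable (\<lambda>n. K * ((1 / 4) ^ n * (1 + real n) powr (- \<sigma>)))"
    by (rule summable_mult)
  then show ?thesis
  proof (rule summable_comparison_test'[where N = 0])
    fix n :: nat
    have "norm (zeta (of_nat (2 * Suc n)) - 1) * real (Suc n) powr (- \<sigma>) \<le>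
          K * (1 / 4) ^ n * real (Suc n) powr (- \<sigma>)"
      by (intro mult_right_mono K) auto
    then show "norm (norm (zeta (of_nat (2 * Suc n)) - 1) * real (Suc n) powr (- \<sigma>)) \<le>
          K * ((1 / 4) ^ n * (1 + real n) powr (- \<sigma>))"
      by (simp add: mult.assoc)
  qed
qed

lemma E_fun_holomorphic: "E_fun holomorphic_on UNIV"
proof -
  have "E_fun holomorphic_on (\<Union>a. {s. Re s > a})"
  proof (rule holomorphic_on_UN_open)
    show "E_fun holomorphic_on {s. Re s > a}" for a
      unfolding E_fun_def by (rule dirichlet_series_holomorphic[OF summable_E_fun_coeffs])
  qed (auto intro: open_halfspace_Re_gt)
  also have "(\<Union>a. {s. Re s > a}) = UNIV"
    by (auto intro: lt_ex)
  finally show ?thesis .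
qed

lemma E_fun_bounded:
  obtains M where "\<And>s. Re s \<ge> \<sigma> \<Longrightarrow> norm (E_fun s) \<le> M"
  using dirichlet_series_summable(2)[OF summable_E_fun_coeffs, of \<sigma>] that
  unfolding E_fun_def by blast

lemma zeta_large_in_left_strip:
  fixes C \<delta> B :: real
  assumes \<delta>: "\<delta> > 0"
  obtains T where "\<And>s. - C \<le> Re s \<Longrightarrow> Re s \<le> - \<delta> \<Longrightarrow> \<bar>Im s\<bar> \<ge> T \<Longrightarrow> norm (zeta s) > B"
proof -
  \<comment> \<open>In the strip Re (1 - s) is at least 1 + \<delta>, which is why it must stay away
    from the imaginary axis.\<close>
  obtain c where c: "c > 0" "\<And>w. Re w \<ge> 1 + \<delta> \<Longrightarrow> norm (zeta w) \<ge> c"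
    using zeta_bounded_away_from_0[of "1 + \<delta>"] \<delta> by auto
  \<comment> \<open>A positive minimum of Gamma on a compact interval containing 1 - Re s for every
    s in the strip; \<open>\<bar>C\<bar>\<close> is taken since no sign of \<open>C\<close> is
    assumed here.\<close>
  obtain m where m: "m > 0" "\<And>x. 1 \<le> x \<Longrightarrow> x \<le> 1 + \<bar>C\<bar> \<Longrightarrow> Gamma (x::real) \<ge> m"
  proof -
    have "continuous_on {1..1 + \<bar>C\<bar>} (Gamma :: real \<Rightarrow> real)"
      by (intro continuous_on_Gamma continuous_on_id) (auto elim!: nonpos_Ints_cases)
    then obtain x where "x \<in> {1..1 + \<bar>C\<bar>}" "\<And>y. y \<in> {1..1 + \<bar>C\<bar>} \<Longrightarrow> Gamma x \<le> (Gamma y :: real)"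
      using continuous_attains_inf[of "{1..1 + \<bar>C\<bar>}" "Gamma :: real \<Rightarrow> real"] by auto
    then show ?thesis by (intro that[of "Gamma x"]) auto
  qed
  \<comment> \<open>Product of the constants of the factors: (2 pi)^(-C - 1) from the power at the
    left edge, \<open>m\<close> from Gamma, 1 / 4 from the sine and \<open>c\<close> from
    zeta.\<close>
  define A where "A = 2 * (2 * pi) powr (- C - 1) * (m / 4) * c"
  have A: "A > 0" using c m by (simp add: A_def)
  have lower: "norm (zeta s) \<ge> A * sqrt (pi * \<bar>Im s\<bar>)"
    if s: "- C \<le> Re s" "Re s \<le> - \<delta>" "\<bar>Im s\<bar> \<ge> 1" for s
  proof -
    define t where "t = \<bar>Im s\<bar>"
    have t: "t \<ge> 1" using s by (simp add: t_def)
    have powr: "norm ((2 * of_real pi) powr (s - 1) :: complex) \<ge> (2 * pi) powr (- C - 1)"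
    proof -
      have "norm (of_real (2 * pi) powr (s - 1) :: complex) = (2 * pi) powr (Re s - 1)"
        by (subst norm_powr_real_powr) auto
      moreover have "(2 * pi) powr (- C - 1) \<le> (2 * pi) powr (Re s - 1)"
        using s pi_gt3 by (intro powr_mono) auto
      ultimately show ?thesis by simp
    qed
    have sin: "norm (sin (of_real pi * s / 2)) \<ge> exp (pi * t / 2) / 4"
    proof -
      have "\<bar>Im (of_real pi * s / 2)\<bar> = pi * t / 2"
        by (simp add: t_def abs_mult)
      then have "norm (sin (of_real pi * s / 2)) \<ge> (exp (pi * t / 2) - 1) / 2"
        using norm_sin_ge[of "of_real pi * s / 2"] by simp
      \<comment> \<open>Once the exponential is at least 2, half of it absorbs the -1 of the sine
        bound; this produces the 1 / 4.\<close>
      moreover have "exp (pi * t / 2) \<ge> 2"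
      proof -
        have "3 * 1 \<le> pi * t" using t pi_gt3 by (intro mult_mono) auto
        then have "2 \<le> 1 + pi * t / 2" by simp
        also have "\<dots> \<le> exp (pi * t / 2)" by (rule exp_ge_add_one_self)
        finally show ?thesis .
      qed
      ultimately show ?thesis by simp
    qed
    have Gamma: "norm (Gamma (1 - s)) \<ge> m * (sqrt (pi * t) * exp (- pi * t / 2))"
    proof -
      have "1 - s = Complex (1 - Re s) (- Im s)" by (simp add: complex_eq_iff)
      then have "norm (Gamma (1 - s)) \<ge> Gamma (1 - Re s) * norm (Gamma (Complex 1 (- Im s)))"
        using norm_Gamma_ge[of "1 - Re s" "- Im s"] s \<delta> by simp
      moreover have "Gamma (1 - Re s) * norm (Gamma (Complex 1 (- Im s))) \<ge> m * (sqrt (pi * t) * exp (- pi * t / 2))"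
        using norm_Gamma_one_plus_imaginary[of "- Im s"] m(2)[of "1 - Re s"] m(1) s \<delta> t
        by (intro mult_mono) (auto simp: t_def)
      ultimately show ?thesis by linarith
    qed
    have "A * sqrt (pi * t) = 2 * (2 * pi) powr (- C - 1) * (exp (pi * t / 2) / 4) *
            (m * (sqrt (pi * t) * exp (- pi * t / 2))) * c"
    proof -
      have "exp (pi * t / 2) * exp (- pi * t / 2) = 1" by (simp flip: exp_add)
      then have *: "2 * p * (exp (pi * t / 2) / 4) * (m * (q * exp (- pi * t / 2))) * c = 2 * p * (m / 4) * c * q" for p q
        by algebra
      show ?thesis unfolding A_def by (rule *[symmetric])
    qed
    also have "\<dots> \<le> 2 * norm ((2 * of_real pi) powr (s - 1) :: complex) * norm (sin (of_real pi * s / 2)) *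
            norm (Gamma (1 - s)) * norm (zeta (1 - s))"
      using c(1) m(1) c(2)[of "1 - s"] s t
      by (intro mult_mono powr sin Gamma mult_nonneg_nonneg) auto
    also have "\<dots> = norm (zeta s)"
      using zeta_functional_equation[of s] s \<delta> by (simp add: norm_mult)
    finally show ?thesis by (simp add: t_def)
  qed
  have "filterlim (\<lambda>t. A * sqrt (pi * t)) at_top at_top"
    using A by real_asymp
  then have "eventually (\<lambda>t. A * sqrt (pi * t) > B) at_top"
    by (auto simp: filterlim_at_top_dense)
  then obtain T where T: "\<And>t. t \<ge> T \<Longrightarrow> A * sqrt (pi * t) > B"
    by (auto simp: eventually_at_top_linorder)
  show ?thesis
  proof (rule that)
    \<comment> \<open>The maximum with 1 is needed because \<open>lower\<close> was shown for
      \<open>\<bar>Im s\<bar> \<ge> 1\<close>.\<close>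
    fix s :: complex assume "- C \<le> Re s" "Re s \<le> - \<delta>" "\<bar>Im s\<bar> \<ge> max T 1"
    then show "norm (zeta s) > B"
      using lower[of s] T[of "\<bar>Im s\<bar>"] by force
  qed
qed

theorem proposition4p5:
  fixes C \<delta> :: real
  assumes "C > \<delta>" and "\<delta> > 0"
  shows "finite {s :: complex. - C \<le> Re s \<and> Re s \<le> - \<delta> \<and> D_fun s = 0}"
proof -
  obtain M where M: "\<And>s. Re s \<ge> - C \<Longrightarrow> norm (E_fun s) \<le> M"
    using E_fun_bounded by blast
  \<comment> \<open>Stated for every \<open>B\<close>: the value 0 confines the zeros, and the
    modulus of a supposed constant value refutes constancy.\<close>
  have D_large: "\<exists>T. \<forall>s. - C \<le> Re s \<longrightarrow> Re s \<le> - \<delta> \<longrightarrow> \<bar>Im s\<bar> \<ge> T \<longrightarrow> norm (D_fun s) > B" for B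
  proof -
    obtain T where T: "\<And>s. - C \<le> Re s \<Longrightarrow> Re s \<le> - \<delta> \<Longrightarrow> \<bar>Im s\<bar> \<ge> T \<Longrightarrow> norm (zeta s) > B + M"
      using zeta_large_in_left_strip[OF assms(2)] by blast
    have "norm (D_fun s) > B" if "- C \<le> Re s" "Re s \<le> - \<delta>" "\<bar>Im s\<bar> \<ge> T" for s
      using T[OF that] M[of s] that norm_diff_ineq[of "zeta s" "E_fun s"] by (simp add: D_fun_def)
    then show ?thesis by blast
  qed
  obtain T where T: "\<And>s. - C \<le> Re s \<Longrightarrow> Re s \<le> - \<delta> \<Longrightarrow> \<bar>Im s\<bar> \<ge> T \<Longrightarrow> norm (D_fun s) > 0"
    using D_large[of 0] by blast
  let ?K = "cbox (Complex (- C) (- T)) (Complex (- \<delta>) T)"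
  have "finite {s \<in> ?K. D_fun s = 0}"
  proof (rule holomorphic_compact_finite_zeros)
    \<comment> \<open>The whole punctured plane serves as the connected domain; the rectangle avoids
      1 because it lies in Re s < 0.\<close>
    show "D_fun holomorphic_on (- {1})"
      unfolding D_fun_def
      by (intro holomorphic_intros zeta_holomorphic holomorphic_on_subset[OF E_fun_holomorphic]) auto
    show "connected (- {1::complex})" by (rule connected_punctured_universe) simp
    show "?K \<subseteq> - {1}" using assms by (auto simp: in_cbox_complex_iff)
    show "\<not> D_fun constant_on (- {1})"
    proof
      assume "D_fun constant_on (- {1})"
      then obtain k where k: "\<And>s. s \<noteq> 1 \<Longrightarrow> D_fun s = k" by (auto simp: constant_on_def)
      obtain T' where T': "\<And>s. - C \<le> Re s \<Longrightarrow> Re s \<le> - \<delta> \<Longrightarrow> \<bar>Im s\<bar> \<ge> T' \<Longrightarrow> norm (D_fun s) > norm k"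
        using D_large[of "norm k"] by blast
      \<comment> \<open>A point on the right edge of the strip, high enough for the modulus of D to
        exceed the supposed constant.\<close>
      have "Complex (- \<delta>) T' \<noteq> 1" using assms by (auto simp: complex_eq_iff)
      with k T'[of "Complex (- \<delta>) T'"] assms abs_ge_self[of T'] show False by simp
    qed
  qed auto
  moreover have "{s :: complex. - C \<le> Re s \<and> Re s \<le> - \<delta> \<and> D_fun s = 0} \<subseteq> {s \<in> ?K. D_fun s = 0}"
  proof
    fix s :: complex assume s: "s \<in> {s. - C \<le> Re s \<and> Re s \<le> - \<delta> \<and> D_fun s = 0}"
    then have "\<bar>Im s\<bar> < T" using T[of s] by force
    with s show "s \<in> {s \<in> ?K. D_fun s = 0}" by (auto simp: in_cbox_complex_iff)
  qed
  ultimately show ?thesis by (rule finite_subset[rotated])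
qed

end
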